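(* Let $n\ge2$, $d\ge1$, $m_1,\dots,m_n>0$, and let $H$ be the Hamiltonian of the $n$-body problem in $\mathbb{R}^d$, $$H(q,p)=\sum_{i=1}^n\frac{|p_i|^2}{2m_i}-\sum_{1\le i<j\le n}\frac{m_im_j}{|q_i-q_j|},$$ defined on the cotangent bundle of $\{(q_1,\dots,q_n)\in\mathbb{R}^{dn}: q_i\ne q_j \text{ for } i\ne j\}$. For every $c>0$ there is a Riemannian metric on the energy level $\Sigma=H^{-1}(c)$ for which the restriction to $\Sigma$ of the Hamiltonian vector field $X_H$ is a Beltrami field and a solution to the stationary Euler equations.
   Context: The symplectic form is $\omega=dp\wedge dq=\sum_i dp_i\wedge dq_i$, and $X_H$ is defined by $\iota_{X_H}\omega=-dH$. On a $(2k+1)$-dimensional manifold with Riemannian metric $g$ and volume form $\mu$ (not required to be the Riemannian volume form), $\operatorname{curl}X$ is defined by $\iota_{\operatorname{curl}X}\mu=(d\iota_Xg)^k$, where $\iota_Xg=g(X,\cdot)$. A vector field $X$ is Beltrami if $\mathcal{L}_X\mu=0$ and $\operatorname{curl}X=fX$ for some function $f$. The stationary Euler equations are $\iota_Xd\iota_Xg=-dB$ for some function $B$, together with $\mathcal{L}_X\mu=0$. Being Beltrami for a metric $g$ and solving the stationary Euler equations for $g$ mean that this holds for some volume form $\mu$, the same for both. *)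

theory Defs
  imports "HOL-Analysis.Analysis" "HOL-Combinatorics.Permutations"
begin

section \<open>Smooth maps\<close>

text \<open>On an open set \<open>S\<close> of a Euclidean space, asking for all iterated directional derivatives
  to exist and be continuous is the same as being of class $C^k$.\<close>

primrec Ck_on :: "nat \<Rightarrow> 'a::euclidean_space set \<Rightarrow> ('a \<Rightarrow> 'b::real_normed_vector) \<Rightarrow> bool" where
  "Ck_on 0 S f \<longleftrightarrow> continuous_on S f"
| "Ck_on (Suc k) S f \<longleftrightarrow>
     (\<forall>x\<in>S. f differentiable (at x)) \<and> (\<forall>v. Ck_on k S (\<lambda>x. frechet_derivative f (at x) v))"

definition smooth_on :: "'a::euclidean_space set \<Rightarrow> ('a \<Rightarrow> 'b::real_normed_vector) \<Rightarrow> bool" where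
  "smooth_on S f \<longleftrightarrow> (\<forall>k. Ck_on k S f)"


section \<open>Hypersurfaces of a Euclidean space and tensor fields on them\<close>

definition smooth_hypersurface :: "'a::euclidean_space set \<Rightarrow> bool" where
  "smooth_hypersurface M \<longleftrightarrow>
     (\<forall>x\<in>M. \<exists>U (F :: 'a \<Rightarrow> real). open U \<and> x \<in> U \<and> smooth_on U F \<and>
        M \<inter> U = {y \<in> U. F y = 0} \<and>
        (\<forall>y\<in>M \<inter> U. \<exists>v. frechet_derivative F (at y) v \<noteq> 0))"

text \<open>Velocities of curves in \<open>M\<close>. On an embedded submanifold, requiring differentiability
  of the curve only at time \<open>0\<close> yields the same space as requiring smoothness.\<close>

definition tangent_space :: "'a::euclidean_space set \<Rightarrow> 'a \<Rightarrow> 'a set" where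
  "tangent_space M x =
     {v. \<exists>\<gamma> :: real \<Rightarrow> 'a. \<gamma> 0 = x \<and> (\<exists>\<epsilon>>0. \<forall>t. \<bar>t\<bar> < \<epsilon> \<longrightarrow> \<gamma> t \<in> M) \<and>
        (\<gamma> has_vector_derivative v) (at 0)}"

definition tangent_tuples :: "'a::euclidean_space set \<Rightarrow> 'a \<Rightarrow> nat \<Rightarrow> 'a list set" where
  "tangent_tuples M x k = {vs. length vs = k \<and> set vs \<subseteq> tangent_space M x}"

text \<open>A covariant tensor field of degree \<open>k\<close> takes a point and the list of its \<open>k\<close> vector
  arguments. On \<open>M\<close> only its values at points \<open>x \<in> M\<close> and on \<open>tangent_tuples M x k\<close> matter, and
  all predicates below depend on these values alone. Functions are tensor fields of degree \<open>0\<close>.\<close>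

type_synonym 'a tensor_field = "'a \<Rightarrow> 'a list \<Rightarrow> real"

abbreviation function_tensor :: "('a \<Rightarrow> real) \<Rightarrow> 'a tensor_field" where
  "function_tensor f \<equiv> (\<lambda>x vs. f x)"

definition multilinear_form :: "nat \<Rightarrow> ('a::real_vector list \<Rightarrow> real) \<Rightarrow> bool" where
  "multilinear_form k \<phi> \<longleftrightarrow>
     (\<forall>vs ws u w a b. length vs + Suc (length ws) = k \<longrightarrow>
        \<phi> (vs @ (a *\<^sub>R u + b *\<^sub>R w) # ws) = a * \<phi> (vs @ u # ws) + b * \<phi> (vs @ w # ws))"

definition alternating_form :: "nat \<Rightarrow> ('a::real_vector list \<Rightarrow> real) \<Rightarrow> bool" where
  "alternating_form k \<phi> \<longleftrightarrow>
     multilinear_form k \<phi> \<and> (\<forall>vs. length vs = k \<and> \<not> distinct vs \<longrightarrow> \<phi> vs = 0)"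

definition ambient_tensor :: "'a::euclidean_space set \<Rightarrow> nat \<Rightarrow> 'a tensor_field \<Rightarrow> bool" where
  "ambient_tensor U k A \<longleftrightarrow>
     (\<forall>y\<in>U. multilinear_form k (A y)) \<and> (\<forall>vs. length vs = k \<longrightarrow> smooth_on U (\<lambda>y. A y vs))"

definition ambient_form :: "'a::euclidean_space set \<Rightarrow> nat \<Rightarrow> 'a tensor_field \<Rightarrow> bool" where
  "ambient_form U k A \<longleftrightarrow> ambient_tensor U k A \<and> (\<forall>y\<in>U. alternating_form k (A y))"

text \<open>\<open>A\<close> restricts (pulls back) to \<open>a\<close> on \<open>M \<inter> U\<close>.\<close>

definition restricts_to ::
    "'a::euclidean_space set \<Rightarrow> 'a set \<Rightarrow> nat \<Rightarrow> 'a tensor_field \<Rightarrow> 'a tensor_field \<Rightarrow> bool" where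
  "restricts_to M U k A a \<longleftrightarrow> (\<forall>y\<in>M \<inter> U. \<forall>vs\<in>tangent_tuples M y k. A y vs = a y vs)"

text \<open>Smoothness on an embedded submanifold is the existence of local smooth extensions.\<close>

definition smooth_tensor :: "'a::euclidean_space set \<Rightarrow> nat \<Rightarrow> 'a tensor_field \<Rightarrow> bool" where
  "smooth_tensor M k a \<longleftrightarrow>
     (\<forall>x\<in>M. \<exists>U A. open U \<and> x \<in> U \<and> ambient_tensor U k A \<and> restricts_to M U k A a)"

definition smooth_form :: "'a::euclidean_space set \<Rightarrow> nat \<Rightarrow> 'a tensor_field \<Rightarrow> bool" where
  "smooth_form M k a \<longleftrightarrow>
     (\<forall>x\<in>M. \<exists>U A. open U \<and> x \<in> U \<and> ambient_form U k A \<and> restricts_to M U k A a)"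

definition vector_field :: "'a::euclidean_space set \<Rightarrow> ('a \<Rightarrow> 'a) \<Rightarrow> bool" where
  "vector_field M X \<longleftrightarrow>
     (\<forall>x\<in>M. X x \<in> tangent_space M x) \<and>
     (\<forall>x\<in>M. \<exists>U Y. open U \<and> x \<in> U \<and> smooth_on U Y \<and> (\<forall>y\<in>M \<inter> U. Y y = X y))"

definition contract :: "('a \<Rightarrow> 'a) \<Rightarrow> 'a tensor_field \<Rightarrow> 'a tensor_field" where
  "contract X a = (\<lambda>x vs. a x (X x # vs))"


section \<open>Exterior calculus\<close>

text \<open>Determinant convention, so that $(\alpha\wedge\beta)(u,v)=\alpha(u)\beta(v)-\alpha(v)\beta(u)$
  for \<open>1\<close>-forms.\<close>

definition wedge :: "nat \<Rightarrow> nat \<Rightarrow> 'a tensor_field \<Rightarrow> 'a tensor_field \<Rightarrow> 'a tensor_field" where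
  "wedge p q a b = (\<lambda>x vs.
     (\<Sum>\<sigma> | \<sigma> permutes {..<p + q}.
        of_int (sign \<sigma>) * a x (map (\<lambda>i. vs ! \<sigma> i) [0..<p]) * b x (map (\<lambda>i. vs ! \<sigma> i) [p..<p + q]))
     / (fact p * fact q))"

text \<open>Powers of a \<open>2\<close>-form.\<close>

primrec wedge_power :: "'a tensor_field \<Rightarrow> nat \<Rightarrow> 'a tensor_field" where
  "wedge_power b 0 = function_tensor (\<lambda>x. 1)"
| "wedge_power b (Suc k) = wedge 2 (2 * k) b (wedge_power b k)"

text \<open>The exterior derivative on an open set of the ambient space, evaluated on constant vector
  fields: $dA(v_0,\dots,v_k)=\sum_i(-1)^i\,D_{v_i}\bigl(A(v_0,\dots,\widehat{v_i},\dots,v_k)\bigr)$.\<close>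

definition ambient_d :: "'a::euclidean_space tensor_field \<Rightarrow> 'a tensor_field" where
  "ambient_d A = (\<lambda>y vs. \<Sum>i<length vs.
     (- 1) ^ i * frechet_derivative (\<lambda>z. A z (take i vs @ drop (Suc i) vs)) (at y) (vs ! i))"

text \<open>\<open>b = da\<close> on \<open>M\<close> for a \<open>k\<close>-form \<open>a\<close>. Since \<open>d\<close> commutes with restriction to \<open>M\<close>, the
  result does not depend on the chosen local extensions.\<close>

definition has_exterior_derivative ::
    "'a::euclidean_space set \<Rightarrow> nat \<Rightarrow> 'a tensor_field \<Rightarrow> 'a tensor_field \<Rightarrow> bool" where
  "has_exterior_derivative M k a b \<longleftrightarrow>
     (\<forall>x\<in>M. \<exists>U A. open U \<and> x \<in> U \<and> ambient_form U k A \<and>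
        restricts_to M U k A a \<and> restricts_to M U (Suc k) (ambient_d A) b)"

text \<open>The Lie derivative on an open set of the ambient space, in coordinates:
  $(\mathcal L_YA)(v_1,\dots,v_k)=D_Y\bigl(A(v_1,\dots,v_k)\bigr)+\sum_iA(v_1,\dots,D_{v_i}Y,\dots,v_k)$.\<close>

definition ambient_lie :: "('a::euclidean_space \<Rightarrow> 'a) \<Rightarrow> 'a tensor_field \<Rightarrow> 'a tensor_field" where
  "ambient_lie Y A = (\<lambda>y vs. frechet_derivative (\<lambda>z. A z vs) (at y) (Y y) +
     (\<Sum>i<length vs. A y (vs[i := frechet_derivative Y (at y) (vs ! i)])))"

text \<open>The Lie derivative of the \<open>k\<close>-form \<open>a\<close> along the vector field \<open>X\<close> on \<open>M\<close> is \<open>b\<close>; again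
  independent of the extensions, because \<open>X\<close> is tangent to \<open>M\<close>.\<close>

definition has_lie_derivative ::
    "'a::euclidean_space set \<Rightarrow> nat \<Rightarrow> ('a \<Rightarrow> 'a) \<Rightarrow> 'a tensor_field \<Rightarrow> 'a tensor_field \<Rightarrow> bool" where
  "has_lie_derivative M k X a b \<longleftrightarrow>
     (\<forall>x\<in>M. \<exists>U Y A. open U \<and> x \<in> U \<and> smooth_on U Y \<and> (\<forall>y\<in>M \<inter> U. Y y = X y) \<and>
        ambient_form U k A \<and> restricts_to M U k A a \<and> restricts_to M U k (ambient_lie Y A) b)"


section \<open>Metrics, volume forms, Beltrami fields and stationary Euler flows\<close>

definition riemannian_metric :: "'a::euclidean_space set \<Rightarrow> 'a tensor_field \<Rightarrow> bool" where
  "riemannian_metric M g \<longleftrightarrow> smooth_tensor M 2 g \<and>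
     (\<forall>x\<in>M. \<forall>u\<in>tangent_space M x. \<forall>v\<in>tangent_space M x. g x [u, v] = g x [v, u]) \<and>
     (\<forall>x\<in>M. \<forall>v\<in>tangent_space M x. v \<noteq> 0 \<longrightarrow> g x [v, v] > 0)"

text \<open>A volume form on an \<open>N\<close>-dimensional \<open>M\<close>.\<close>

definition volume_form :: "'a::euclidean_space set \<Rightarrow> nat \<Rightarrow> 'a tensor_field \<Rightarrow> bool" where
  "volume_form M N \<mu> \<longleftrightarrow> smooth_form M N \<mu> \<and> (\<forall>x\<in>M. \<exists>vs\<in>tangent_tuples M x N. \<mu> x vs \<noteq> 0)"

text \<open>In the following \<open>M\<close> has dimension \<open>2 * k + 1\<close>. The field \<open>C\<close> is the curl of \<open>X\<close> if
  $\iota_C\mu=(d\iota_Xg)^k$; as \<open>\<mu>\<close> is a volume form, this determines \<open>C\<close>.\<close>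

definition is_curl ::
    "'a::euclidean_space set \<Rightarrow> nat \<Rightarrow> 'a tensor_field \<Rightarrow> 'a tensor_field \<Rightarrow> ('a \<Rightarrow> 'a) \<Rightarrow> ('a \<Rightarrow> 'a) \<Rightarrow> bool"
  where
  "is_curl M k g \<mu> X C \<longleftrightarrow> vector_field M C \<and>
     (\<exists>b. has_exterior_derivative M 1 (contract X g) b \<and>
        (\<forall>x\<in>M. \<forall>vs\<in>tangent_tuples M x (2 * k). contract C \<mu> x vs = wedge_power b k x vs))"

definition volume_preserving :: "'a::euclidean_space set \<Rightarrow> nat \<Rightarrow> 'a tensor_field \<Rightarrow> ('a \<Rightarrow> 'a) \<Rightarrow> bool"
  where
  "volume_preserving M k \<mu> X \<longleftrightarrow> has_lie_derivative M (2 * k + 1) X \<mu> (\<lambda>x vs. 0)"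

definition beltrami ::
    "'a::euclidean_space set \<Rightarrow> nat \<Rightarrow> 'a tensor_field \<Rightarrow> 'a tensor_field \<Rightarrow> ('a \<Rightarrow> 'a) \<Rightarrow> bool" where
  "beltrami M k g \<mu> X \<longleftrightarrow> vector_field M X \<and> volume_preserving M k \<mu> X \<and>
     (\<exists>f. smooth_tensor M 0 (function_tensor f) \<and> is_curl M k g \<mu> X (\<lambda>x. f x *\<^sub>R X x))"

definition stationary_euler ::
    "'a::euclidean_space set \<Rightarrow> nat \<Rightarrow> 'a tensor_field \<Rightarrow> 'a tensor_field \<Rightarrow> ('a \<Rightarrow> 'a) \<Rightarrow> bool" where
  "stationary_euler M k g \<mu> X \<longleftrightarrow> vector_field M X \<and> volume_preserving M k \<mu> X \<and>
     (\<exists>B b db. has_exterior_derivative M 1 (contract X g) b \<and>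
        has_exterior_derivative M 0 (function_tensor B) db \<and>
        (\<forall>x\<in>M. \<forall>vs\<in>tangent_tuples M x 1. contract X b x vs = - db x vs))"


section \<open>The \<open>n\<close>-body problem\<close>

text \<open>Points \<open>(q, p)\<close>, where \<open>q $ i\<close> and \<open>p $ i\<close> are position and momentum of the \<open>i\<close>-th body.\<close>

type_synonym ('d, 'n) phase = "(real ^ 'd ^ 'n) \<times> (real ^ 'd ^ 'n)"

definition phase_space :: "('d::finite, 'n::finite) phase set" where
  "phase_space = {(q, p). \<forall>i j. i \<noteq> j \<longrightarrow> q $ i \<noteq> q $ j}"

definition nbody_hamiltonian ::
    "('n::{finite,linorder} \<Rightarrow> real) \<Rightarrow> ('d::finite, 'n) phase \<Rightarrow> real" where
  "nbody_hamiltonian m = (\<lambda>(q, p).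
     (\<Sum>i\<in>UNIV. (norm (p $ i))\<^sup>2 / (2 * m i)) -
     (\<Sum>(i, j) | i < j. m i * m j / norm (q $ i - q $ j)))"

text \<open>$\omega=\sum_idp_i\wedge dq_i$.\<close>

definition symplectic_form ::
    "('d::finite, 'n::finite) phase \<Rightarrow> ('d, 'n) phase \<Rightarrow> real" where
  "symplectic_form u v = (\<Sum>i\<in>UNIV. snd u $ i \<bullet> fst v $ i - snd v $ i \<bullet> fst u $ i)"

text \<open>$\iota_{X_H}\omega=-dH$.\<close>

definition hamiltonian_vector_field ::
    "(('d::finite, 'n::finite) phase \<Rightarrow> real) \<Rightarrow> ('d, 'n) phase \<Rightarrow> ('d, 'n) phase" where
  "hamiltonian_vector_field H x =
     (THE X. \<forall>v. symplectic_form X v = - frechet_derivative H (at x) v)"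

end

theory Submission
  imports Defs "Jordan_Normal_Form.Determinant"
begin

text \<open>On a level of positive energy the function $S=q\cdot p$ increases strictly along the motion. With
  kinetic energy $K$ and $V=\sum_{i<j}m_im_j/|q_i-q_j|$, homogeneity of $V$ gives the Lagrange--Jacobi
  identity $X_H(S)=2K-V=K+H$, and this is positive when $H=c>0$.

  Any closed $1$-form that is positive on a nonvanishing field is of the form $\iota_Xg$ for a metric:
  declare $X$ orthogonal to the kernel of the form. Applied to $\alpha=dS$, this gives a metric on
  $\Sigma$ with $\iota_{X_H}g=dS$, hence $d\iota_{X_H}g=0$. Consequently $\operatorname{curl}X_H=0$
  for every volume form (this uses $k\geq1$), so that $X_H$ is Beltrami with factor $0$, and the
  stationary Euler equation holds with constant $B$.

  What remains is an invariant volume form. The field $X_H$ preserves the Euclidean volume of phase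
  space and the function $H$, hence also their quotient on $\Sigma$; concretely this is $\iota_Y\det$ for
  the transversal field $Y=(0,p)/(2K)$, which satisfies $dH(Y)=1$ and has a bracket with $X_H$ tangent
  to $\Sigma$. The invariance is \<open>ambient_lie_volume\<close> and rests on \<open>sum_volume_det_update_linear\<close>.

  The locale \<open>irrotational_level_set\<close> carries out the argument for level sets in a Euclidean space, where
  \<open>tangent_space_level_set\<close> identifies the tangent spaces with the kernels of the differential; and
  \<open>irrotational_level_set_nbody\<close> verifies its assumptions on the region of positive energy.\<close>

section \<open>The Euclidean determinant as a volume form\<close>

text \<open>The infix signs for entries and products of vectors of variable length would clash with vector
  components and the inner product.\<close>

no_notation vec_index (infixl "$" 100)
no_notation scalar_prod (infix "\<bullet>" 70)

definition basis_list :: "'a::euclidean_space list" where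
  "basis_list = (SOME bs. distinct bs \<and> set bs = Basis)"

lemma basis_list:
  shows distinct_basis_list: "distinct (basis_list :: 'a::euclidean_space list)"
    and set_basis_list: "set (basis_list :: 'a list) = Basis"
    and length_basis_list: "length (basis_list :: 'a list) = DIM('a)"
proof -
  have "distinct (basis_list :: 'a list) \<and> set (basis_list :: 'a list) = Basis"
    unfolding basis_list_def
    by (rule someI_ex) (metis finite_Basis finite_distinct_list)
  then show "distinct (basis_list :: 'a list)" "set (basis_list :: 'a list) = Basis"
    "length (basis_list :: 'a list) = DIM('a)"
    by (auto dest: distinct_card)
qed

lemma sum_basis_list:
  "(\<Sum>j<DIM('a). f (basis_list ! j)) = (\<Sum>b\<in>(Basis :: 'a::euclidean_space set). f b)"
  using sum.reindex_bij_betw[OF bij_betw_nth[OF distinct_basis_list refl refl], of f]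
  by (simp add: basis_list)

text \<open>Its rows are the coordinates of the vectors. Determinants of matrices indexed by natural numbers
  are used because a Euclidean space has no canonical index type of cardinality \<open>DIM('a)\<close>.\<close>

definition coord_matrix :: "'a::euclidean_space list \<Rightarrow> real mat" where
  "coord_matrix vs = mat DIM('a) DIM('a) (\<lambda>(i, j). vs ! i \<bullet> basis_list ! j)"

definition volume_det :: "'a::euclidean_space list \<Rightarrow> real" where
  "volume_det vs = Determinant.det (coord_matrix vs)"

lemma coord_matrix_carrier [simp]:
  "coord_matrix (vs :: 'a::euclidean_space list) \<in> carrier_mat DIM('a) DIM('a)"
  by (simp add: coord_matrix_def)

text \<open>The minor in question omits row \<open>i\<close>.\<close>

lemma cofactor_coord_matrix_update:
  assumes "i < DIM('a)" "j < DIM('a)"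
  shows "cofactor (coord_matrix (vs[i := w] :: 'a::euclidean_space list)) i j
    = cofactor (coord_matrix vs) i j"
proof -
  have "mat_delete (coord_matrix (vs[i := w])) i j = mat_delete (coord_matrix vs) i j"
    using assms by (intro eq_matI) (auto simp: mat_delete_def coord_matrix_def)
  then show ?thesis by (simp add: cofactor_def)
qed

text \<open>Laplace expansion along row \<open>i\<close>: the vector on the right, a generalised cross product, does not
  depend on the entry \<open>i\<close> of \<open>vs\<close>, which makes linearity in that entry visible.\<close>

lemma volume_det_update:
  fixes vs :: "'a::euclidean_space list"
  assumes "length vs = DIM('a)" "i < DIM('a)"
  shows "volume_det (vs[i := w])
    = w \<bullet> (\<Sum>j<DIM('a). cofactor (coord_matrix vs) i j *\<^sub>R basis_list ! j)"
proof -
  have "volume_det (vs[i := w])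
      = (\<Sum>j<DIM('a). coord_matrix (vs[i := w]) $$ (i, j) * cofactor (coord_matrix (vs[i := w])) i j)"
    unfolding volume_det_def by (rule laplace_expansion_row) (use assms in auto)
  also have "\<dots> = (\<Sum>j<DIM('a). (w \<bullet> basis_list ! j) * cofactor (coord_matrix vs) i j)"
    using assms by (intro sum.cong refl) (auto simp: cofactor_coord_matrix_update, simp add: coord_matrix_def)
  finally show ?thesis by (simp add: inner_sum_right mult.commute)
qed

lemma linear_volume_det_update:
  fixes vs :: "'a::euclidean_space list"
  assumes "length vs = DIM('a)" "i < DIM('a)"
  shows "linear (\<lambda>w. volume_det (vs[i := w]))"
  unfolding volume_det_update[OF assms] by (auto intro!: linearI simp: inner_add_left)

lemma volume_det_not_distinct:
  fixes vs :: "'a::euclidean_space list"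
  assumes "length vs = DIM('a)" "\<not> distinct vs"
  shows "volume_det vs = 0"
proof -
  obtain i j where ij: "i < length vs" "j < length vs" "i \<noteq> j" "vs ! i = vs ! j"
    using assms by (auto simp: distinct_conv_nth)
  show ?thesis unfolding volume_det_def
  proof (rule det_identical_rows[OF coord_matrix_carrier ij(3)])
    show "Matrix.row (coord_matrix vs) i = Matrix.row (coord_matrix vs) j"
      using ij assms by (intro eq_vecI) (auto simp: coord_matrix_def)
  qed (use ij assms in auto)
qed

text \<open>A kernel vector of the coordinate matrix is a vector orthogonal to the whole list. This is the
  form in which degeneracy appears on a hypersurface: vectors tangent to it are all orthogonal to
  the normal.\<close>

lemma volume_det_eq_0_iff:
  fixes vs :: "'a::euclidean_space list"
  assumes "length vs = DIM('a)"
  shows "volume_det vs = 0 \<longleftrightarrow> (\<exists>z. z \<noteq> 0 \<and> (\<forall>v\<in>set vs. v \<bullet> z = 0))"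
proof
  assume "volume_det vs = 0"
  then obtain x where x: "x \<in> carrier_vec DIM('a)" "x \<noteq> 0\<^sub>v DIM('a)"
      "coord_matrix vs *\<^sub>v x = 0\<^sub>v DIM('a)"
    using det_0_iff_vec_prod_zero[OF coord_matrix_carrier, of vs] unfolding volume_det_def by auto
  define z where "z = (\<Sum>j<DIM('a). vec_index x j *\<^sub>R (basis_list ! j :: 'a))"
  have coord: "z \<bullet> basis_list ! i = vec_index x i" if "i < DIM('a)" for i
  proof -
    have "z \<bullet> basis_list ! i = (\<Sum>j<DIM('a). if j = i then vec_index x j else 0)"
      unfolding z_def inner_sum_left
      using that distinct_basis_list[where 'a='a]
      by (intro sum.cong refl) 
        (auto simp: inner_Basis set_basis_list[symmetric] length_basis_list nth_eq_iff_index_eq)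
    then show ?thesis using that by simp
  qed
  have "z \<noteq> 0"
  proof
    assume "z = 0"
    then have "vec_index x i = 0" if "i < DIM('a)" for i
      using coord[OF that] by simp
    then have "x = 0\<^sub>v DIM('a)" using x(1) by (intro eq_vecI) auto
    then show False using x(2) by simp
  qed
  moreover have "vs ! i \<bullet> z = 0" if "i < DIM('a)" for i
  proof -
    have "0 = vec_index (coord_matrix vs *\<^sub>v x) i" using x(3) that by simp
    also have "\<dots> = (\<Sum>j<DIM('a). (vs ! i \<bullet> basis_list ! j) * vec_index x j)"
      using that x(1) by (simp add: coord_matrix_def scalar_prod_def lessThan_atLeast0)
    also have "\<dots> = vs ! i \<bullet> z"
      by (simp add: z_def inner_sum_right mult.commute)
    finally show ?thesis by simp
  qed
  ultimately show "\<exists>z. z \<noteq> 0 \<and> (\<forall>v\<in>set vs. v \<bullet> z = 0)"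
    using assms by (metis in_set_conv_nth)
next
  assume "\<exists>z. z \<noteq> 0 \<and> (\<forall>v\<in>set vs. v \<bullet> z = 0)"
  then obtain z where z: "z \<noteq> 0" "\<forall>v\<in>set vs. v \<bullet> z = 0" by blast
  define x where "x = vec DIM('a) (\<lambda>j. z \<bullet> basis_list ! j)"
  have "x \<noteq> 0\<^sub>v DIM('a)"
  proof
    assume "x = 0\<^sub>v DIM('a)"
    then have "z \<bullet> basis_list ! j = 0" if "j < DIM('a)" for j
      using that by (metis index_vec index_zero_vec(1) x_def)
    then have "\<forall>b\<in>Basis. z \<bullet> b = 0"
      by (metis basis_list(2,3) in_set_conv_nth)
    then show False using z(1) euclidean_all_zero_iff by blast
  qed
  moreover have "coord_matrix vs *\<^sub>v x = 0\<^sub>v DIM('a)"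
  proof (rule eq_vecI)
    fix i assume i: "i < dim_vec (0\<^sub>v DIM('a) :: real vec)"
    then have "vec_index (coord_matrix vs *\<^sub>v x) i
        = (\<Sum>j<DIM('a). (vs ! i \<bullet> basis_list ! j) * (z \<bullet> basis_list ! j))"
      by (simp add: coord_matrix_def x_def scalar_prod_def lessThan_atLeast0)
    also have "\<dots> = vs ! i \<bullet> z"
      by (simp only: sum_basis_list[where f="\<lambda>b. (vs ! i \<bullet> b) * (z \<bullet> b)"]
          euclidean_inner[of "vs ! i" z])
    also have "\<dots> = 0" using z i assms by simp
    finally show "vec_index (coord_matrix vs *\<^sub>v x) i = vec_index (0\<^sub>v DIM('a)) i" using i by simp
  qed (simp add: coord_matrix_def)
  ultimately show "volume_det vs = 0"
    unfolding volume_det_def det_0_iff_vec_prod_zero[OF coord_matrix_carrier]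
    by (intro exI[of _ x]) (simp add: x_def)
qed

text \<open>The infinitesimal form of $\det(LM)=\det L\det M$. It turns the Lie derivative of the constant
  volume form along a field into the divergence of the field. Expanding each determinant along the
  modified row gives $\sum_{i,j,l}L_{jl}M_{il}C_{ij}$ with cofactors $C_{ij}$, and
  $\sum_iM_{il}C_{ij}=\delta_{jl}\det M$ by the adjugate identity.\<close>

lemma sum_volume_det_update_linear:
  fixes vs :: "'a::euclidean_space list"
  assumes len: "length vs = DIM('a)" and L: "linear L"
  shows "(\<Sum>i<DIM('a). volume_det (vs[i := L (vs ! i)]))
    = (\<Sum>b\<in>Basis. L b \<bullet> b) * volume_det vs"
proof -
  let ?b = "\<lambda>j. basis_list ! j :: 'a" and ?M = "coord_matrix vs"
  have adj: "(\<Sum>i<DIM('a). ?M $$ (i, l) * cofactor ?M i j) = (if j = l then volume_det vs else 0)"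
    if "j < DIM('a)" "l < DIM('a)" for j l
  proof -
    have "(adj_mat ?M * ?M) $$ (j, l) = (if j = l then volume_det vs else 0)"
      using that by (simp add: adj_mat(3)[OF coord_matrix_carrier] volume_det_def)
    moreover have "(adj_mat ?M * ?M) $$ (j, l) = (\<Sum>i<DIM('a). cofactor ?M i j * ?M $$ (i, l))"
      using that by (simp add: adj_mat_def coord_matrix_def times_mat_def scalar_prod_def lessThan_atLeast0)
    ultimately show ?thesis by (simp add: mult.commute)
  qed
  have expand: "L (vs ! i) \<bullet> ?b j = (\<Sum>l<DIM('a). ?M $$ (i, l) * (L (?b l) \<bullet> ?b j))"
    if "i < DIM('a)" for i j
  proof -
    have "L (vs ! i) = L (\<Sum>b\<in>Basis. (vs ! i \<bullet> b) *\<^sub>R b)" by (simp add: euclidean_representation)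
    also have "\<dots> = (\<Sum>b\<in>Basis. (vs ! i \<bullet> b) *\<^sub>R L b)"
      by (simp add: linear_sum[OF L] linear_scale[OF L])
    also have "\<dots> = (\<Sum>l<DIM('a). (vs ! i \<bullet> ?b l) *\<^sub>R L (?b l))" 
      by (simp add: sum_basis_list[where f="\<lambda>b. (vs ! i \<bullet> b) *\<^sub>R L b"])
    finally show ?thesis using that by (simp add: inner_sum_left coord_matrix_def)
  qed
  have "(\<Sum>i<DIM('a). volume_det (vs[i := L (vs ! i)]))
      = (\<Sum>i<DIM('a). \<Sum>j<DIM('a). \<Sum>l<DIM('a). (L (?b l) \<bullet> ?b j) * (?M $$ (i, l) * cofactor ?M i j))"
    by (intro sum.cong refl)
      (simp add: volume_det_update len inner_sum_right expand sum_distrib_right mult_ac sum_distrib_left)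
  also have "\<dots> = (\<Sum>j<DIM('a). \<Sum>i<DIM('a). \<Sum>l<DIM('a). (L (?b l) \<bullet> ?b j) * (?M $$ (i, l) * cofactor ?M i j))"
    by (rule sum.swap)
  also have "\<dots> = (\<Sum>j<DIM('a). \<Sum>l<DIM('a). \<Sum>i<DIM('a). (L (?b l) \<bullet> ?b j) * (?M $$ (i, l) * cofactor ?M i j))"
    by (intro sum.cong refl sum.swap)
  also have "\<dots> = (\<Sum>j<DIM('a). \<Sum>l<DIM('a). (L (?b l) \<bullet> ?b j) * (if j = l then volume_det vs else 0))"
    by (intro sum.cong refl) (simp add: sum_distrib_left[symmetric] adj)
  also have "\<dots> = (\<Sum>j<DIM('a). (L (?b j) \<bullet> ?b j) * volume_det vs)"
    by (intro sum.cong refl) (simp add: if_distrib[of "\<lambda>x. _ * x"] cong: if_cong)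
  finally show ?thesis
    by (simp add: sum_distrib_right sum_basis_list[where f="\<lambda>b. (L b \<bullet> b) * volume_det vs"])
qed


section \<open>Calculus of smooth maps\<close>

lemma Ck_on_cong:
  assumes "open S" "\<And>x. x \<in> S \<Longrightarrow> f x = g x"
  shows "Ck_on k S f \<longleftrightarrow> Ck_on k S g"
  using assms(2)
proof (induction k arbitrary: f g)
  case 0
  then show ?case by (simp cong: continuous_on_cong)
next
  case (Suc k)
  have D: "(f has_derivative D) (at x) \<longleftrightarrow> (g has_derivative D) (at x)" if "x \<in> S" for x D
    using has_derivative_transform_within_open[OF _ assms(1) that] Suc.prems by metis
  have "frechet_derivative f (at x) = frechet_derivative g (at x)" if "x \<in> S" for x
    unfolding frechet_derivative_def using D[OF that] by simp
  then have "Ck_on k S (\<lambda>x. frechet_derivative f (at x) v)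
      \<longleftrightarrow> Ck_on k S (\<lambda>x. frechet_derivative g (at x) v)" for v
    by (intro Suc.IH) simp
  then show ?case using D by (auto simp: differentiable_def)
qed

lemma smooth_on_cong:
  assumes "open S" "\<And>x. x \<in> S \<Longrightarrow> f x = g x"
  shows "smooth_on S f \<longleftrightarrow> smooth_on S g"
  unfolding smooth_on_def using Ck_on_cong[OF assms] by simp

lemma Ck_on_subset:
  assumes "Ck_on k S f" "T \<subseteq> S"
  shows "Ck_on k T f"
  using assms(1)
proof (induction k arbitrary: f)
  case 0
  then show ?case using assms(2) by (auto intro: continuous_on_subset)
next
  case (Suc k)
  then show ?case using assms(2) by auto
qed

lemma smooth_on_subset: "smooth_on S f \<Longrightarrow> T \<subseteq> S \<Longrightarrow> smooth_on T f"
  unfolding smooth_on_def using Ck_on_subset by blast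

lemma Ck_on_Suc_imp_Ck_on: "Ck_on (Suc k) S f \<Longrightarrow> Ck_on k S f"
proof (induction k arbitrary: f)
  case 0
  then show ?case
    by (auto intro!: continuous_at_imp_continuous_on differentiable_imp_continuous_within)
next
  case (Suc k)
  have "Ck_on k S (\<lambda>x. frechet_derivative f (at x) v)" for v
    by (rule Suc.IH) (use Suc.prems in simp)
  then show ?case using Suc.prems by simp
qed

lemma smooth_on_imp_differentiable: "smooth_on S f \<Longrightarrow> x \<in> S \<Longrightarrow> f differentiable (at x)"
  unfolding smooth_on_def by (metis Ck_on.simps(2))

lemma smooth_on_imp_has_derivative:
  "smooth_on S f \<Longrightarrow> x \<in> S \<Longrightarrow> (f has_derivative frechet_derivative f (at x)) (at x)"
  using smooth_on_imp_differentiable frechet_derivative_works by blast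

lemma smooth_on_imp_continuous_on: "smooth_on S f \<Longrightarrow> continuous_on S f"
  unfolding smooth_on_def by (metis Ck_on.simps(1))

lemma Ck_on_const: "Ck_on k S (\<lambda>x. c)"
  by (induction k arbitrary: c) (auto simp: frechet_derivative_const)

text \<open>Any formula for the derivative that holds on the open set may replace \<open>frechet_derivative\<close>; this
  drives the inductions on the order below.\<close>

lemma Ck_on_SucI:
  assumes "open S" "\<And>x. x \<in> S \<Longrightarrow> (f has_derivative D x) (at x)"
    and "\<And>v. Ck_on k S (\<lambda>x. D x v)"
  shows "Ck_on (Suc k) S f"
proof -
  have "Ck_on k S (\<lambda>x. frechet_derivative f (at x) v) \<longleftrightarrow> Ck_on k S (\<lambda>x. D x v)" for v
    by (rule Ck_on_cong[OF assms(1)]) (metis assms(2) frechet_derivative_at)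
  then show ?thesis using assms(2,3) by (auto simp: differentiable_def)
qed

lemma Ck_on_SucD:
  assumes "Ck_on (Suc k) S f"
  shows "\<And>x. x \<in> S \<Longrightarrow> (f has_derivative frechet_derivative f (at x)) (at x)"
    and "\<And>v. Ck_on k S (\<lambda>x. frechet_derivative f (at x) v)"
  using assms by (auto simp: frechet_derivative_works[symmetric])

lemma Ck_on_add:
  assumes "open S" "Ck_on k S f" "Ck_on k S g"
  shows "Ck_on k S (\<lambda>x. f x + g x)"
  using assms(2,3)
proof (induction k arbitrary: f g)
  case 0
  then show ?case by (auto intro: continuous_intros)
next
  case (Suc k)
  show ?case
    by (rule Ck_on_SucI[OF assms(1) has_derivative_add[OF Ck_on_SucD(1)[OF Suc.prems(1)] Ck_on_SucD(1)[OF Suc.prems(2)]]])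
      (assumption | rule Suc.IH Ck_on_SucD(2)[OF Suc.prems(1)] Ck_on_SucD(2)[OF Suc.prems(2)])+
qed

lemma (in bounded_bilinear) Ck_on:
  assumes "open S" "Ck_on k S f" "Ck_on k S g"
  shows "Ck_on k S (\<lambda>x. prod (f x) (g x))"
  using assms(2,3)
proof (induction k arbitrary: f g)
  case 0
  then show ?case by (auto intro: continuous_on)
next
  case (Suc k)
  show ?case
    by (rule Ck_on_SucI[OF assms(1) FDERIV[OF Ck_on_SucD(1)[OF Suc.prems(1)] Ck_on_SucD(1)[OF Suc.prems(2)]]])
      (assumption | rule Ck_on_add assms(1) Suc.IH Ck_on_SucD(2)[OF Suc.prems(1)]
        Ck_on_SucD(2)[OF Suc.prems(2)] Ck_on_Suc_imp_Ck_on[OF Suc.prems(1)]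
        Ck_on_Suc_imp_Ck_on[OF Suc.prems(2)])+
qed

lemma (in bounded_linear) Ck_on:
  assumes "open S" "Ck_on k S g"
  shows "Ck_on k S (\<lambda>x. f (g x))"
  using assms(2)
proof (induction k arbitrary: g)
  case 0
  then show ?case by (auto intro: continuous_on)
next
  case (Suc k)
  show ?case
    by (rule Ck_on_SucI[OF assms(1) has_derivative[OF Ck_on_SucD(1)[OF Suc.prems(1)]]])
      (assumption | rule Suc.IH Ck_on_SucD(2)[OF Suc.prems])+
qed

lemma Ck_on_id: "open S \<Longrightarrow> Ck_on k S (\<lambda>x. x)"
  by (cases k) (auto intro!: Ck_on_SucI derivative_eq_intros Ck_on_const)

text \<open>Differentiating \<open>f powr a\<close> yields a multiple of \<open>f powr (a - 1)\<close>, so the induction needs all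
  exponents at once. Reciprocals and norms are special cases.\<close>

lemma Ck_on_powr:
  fixes f :: "'a::euclidean_space \<Rightarrow> real"
  assumes "open S" "Ck_on k S f" and pos: "\<And>x. x \<in> S \<Longrightarrow> f x > 0"
  shows "Ck_on k S (\<lambda>x. f x powr a)"
  using assms(2)
proof (induction k arbitrary: a)
  case 0
  then show ?case using pos by (auto intro!: continuous_intros dest: less_imp_neq[OF pos])
next
  case (Suc k)
  show ?case
  proof (rule Ck_on_SucI[OF assms(1)])
    fix x assume x: "x \<in> S"
    show "((\<lambda>x. f x powr a) has_derivative
        (\<lambda>v. (a * f x powr (a - 1)) * frechet_derivative f (at x) v)) (at x)"
      by (rule has_derivative_eq_rhs[OF has_derivative_powr[OF Ck_on_SucD(1)[OF Suc.prems x]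
              has_derivative_const pos[OF x]]])
        (use pos[OF x] in \<open>auto simp: fun_eq_iff powr_diff field_simps\<close>)
  next
    fix v
    show "Ck_on k S (\<lambda>x. (a * f x powr (a - 1)) * frechet_derivative f (at x) v)"
      by (intro bounded_bilinear.Ck_on[OF bounded_bilinear_mult assms(1)] Ck_on_const
          Suc.IH Ck_on_SucD(2)[OF Suc.prems] Ck_on_Suc_imp_Ck_on[OF Suc.prems])
  qed
qed

named_theorems smooth_intros

lemma smooth_on_const [smooth_intros]: "smooth_on S (\<lambda>x. c)"
  by (simp add: smooth_on_def Ck_on_const)

lemma smooth_on_id [smooth_intros]: "open S \<Longrightarrow> smooth_on S (\<lambda>x. x)"
  by (simp add: smooth_on_def Ck_on_id)

lemma smooth_on_add [smooth_intros]:
  "open S \<Longrightarrow> smooth_on S f \<Longrightarrow> smooth_on S g \<Longrightarrow> smooth_on S (\<lambda>x. f x + g x)"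
  by (simp add: smooth_on_def Ck_on_add)

lemma (in bounded_bilinear) smooth_on:
  "open S \<Longrightarrow> smooth_on S f \<Longrightarrow> smooth_on S g \<Longrightarrow> smooth_on S (\<lambda>x. prod (f x) (g x))"
  by (simp add: smooth_on_def Ck_on)

lemma (in bounded_linear) smooth_on: "open S \<Longrightarrow> smooth_on S g \<Longrightarrow> smooth_on S (\<lambda>x. f (g x))"
  by (simp add: smooth_on_def Ck_on)

lemmas smooth_on_mult [smooth_intros] = bounded_bilinear.smooth_on[OF bounded_bilinear_mult]
  and smooth_on_scaleR [smooth_intros] = bounded_bilinear.smooth_on[OF bounded_bilinear_scaleR]
  and smooth_on_inner [smooth_intros] = bounded_bilinear.smooth_on[OF bounded_bilinear_inner]
  and smooth_on_minus [smooth_intros] = bounded_linear.smooth_on[OF bounded_linear_minus[OF bounded_linear_ident]]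
  and smooth_on_fst [smooth_intros] = bounded_linear.smooth_on[OF bounded_linear_fst]
  and smooth_on_snd [smooth_intros] = bounded_linear.smooth_on[OF bounded_linear_snd]
  and smooth_on_vec_nth [smooth_intros] = bounded_linear.smooth_on[OF bounded_linear_vec_nth]

lemma smooth_on_diff [smooth_intros]:
  "open S \<Longrightarrow> smooth_on S f \<Longrightarrow> smooth_on S g \<Longrightarrow> smooth_on S (\<lambda>x. f x - g x)"
  using smooth_on_add[of S f "\<lambda>x. - g x"] smooth_on_minus[of S g] by simp

lemma smooth_on_sum [smooth_intros]:
  assumes "open S" "\<And>i. i \<in> I \<Longrightarrow> smooth_on S (f i)"
  shows "smooth_on S (\<lambda>x. \<Sum>i\<in>I. f i x)"
  using assms(2)
  by (induction I rule: infinite_finite_induct) (auto intro!: smooth_intros assms(1))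

lemma smooth_on_Pair [smooth_intros]:
  assumes "open S" "smooth_on S f" "smooth_on S g"
  shows "smooth_on S (\<lambda>x. (f x, g x))"
proof -
  have "smooth_on S (\<lambda>x. (f x, 0) + (0, g x))"
    by (intro smooth_on_add assms
        bounded_linear.smooth_on[OF bounded_linear_Pair[OF bounded_linear_ident bounded_linear_zero]]
        bounded_linear.smooth_on[OF bounded_linear_Pair[OF bounded_linear_zero bounded_linear_ident]])
  then show ?thesis by simp
qed

lemma smooth_on_powr [smooth_intros]:
  fixes f :: "'a::euclidean_space \<Rightarrow> real"
  shows "open S \<Longrightarrow> smooth_on S f \<Longrightarrow> (\<And>x. x \<in> S \<Longrightarrow> f x > 0) \<Longrightarrow> smooth_on S (\<lambda>x. f x powr a)"
  by (simp add: smooth_on_def Ck_on_powr)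

lemma smooth_on_divide [smooth_intros]:
  fixes f g :: "'a::euclidean_space \<Rightarrow> real"
  assumes "open S" "smooth_on S f" "smooth_on S g" "\<And>x. x \<in> S \<Longrightarrow> g x > 0"
  shows "smooth_on S (\<lambda>x. f x / g x)"
proof -
  have "smooth_on S (\<lambda>x. f x * g x powr (-1))" by (intro smooth_intros assms)
  then show ?thesis
    by (subst (asm) smooth_on_cong[OF assms(1), of _ "\<lambda>x. f x / g x"])
      (use assms(4) in \<open>auto simp: powr_minus field_simps less_imp_le\<close>)
qed

lemma smooth_on_power [smooth_intros]:
  fixes f :: "'a::euclidean_space \<Rightarrow> real"
  assumes "open S" "smooth_on S f"
  shows "smooth_on S (\<lambda>x. f x ^ n)"
  by (induction n) (auto intro!: smooth_intros assms)


section \<open>Tangent spaces of level sets\<close>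

text \<open>The kernel of the differential consists of velocities: given $n\cdot v=0$, correct the line
  $x+tv$ in the normal direction to $x+tv+\sigma(t)n\in H^{-1}(c)$. The intermediate value theorem
  provides, for each $\delta>0$ and all small $t$, a correction of size at most $\delta|t|$. Since a
  velocity in \<open>tangent_space\<close> only needs differentiability at time \<open>0\<close>, it suffices to select for
  each $t$ a correction that is smallest up to $t^2$: then $\sigma(t)=o(t)$.\<close>

lemma tangent_space_level_set:
  fixes H :: "'a::euclidean_space \<Rightarrow> real"
  assumes "open U" "x \<in> U" "H x = c" and cont: "continuous_on U H"
    and der: "(H has_derivative (\<lambda>v. n \<bullet> v)) (at x)" and "n \<noteq> 0"
  shows "tangent_space {y \<in> U. H y = c} x = {v. n \<bullet> v = 0}"
proof (intro equalityI subsetI CollectI)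
  fix v assume "v \<in> tangent_space {y \<in> U. H y = c} x"
  then obtain \<gamma> \<epsilon> where \<gamma>: "\<gamma> 0 = x" "\<epsilon> > 0" "\<And>t. \<bar>t\<bar> < \<epsilon> \<Longrightarrow> \<gamma> t \<in> {y \<in> U. H y = c}"
      "(\<gamma> has_vector_derivative v) (at 0)"
    unfolding tangent_space_def by blast
  have "((H \<circ> \<gamma>) has_derivative (\<lambda>v. n \<bullet> v) \<circ> (\<lambda>t. t *\<^sub>R v)) (at 0)"
    by (rule diff_chain_at[OF \<gamma>(4)[unfolded has_vector_derivative_def]]) (simp only: \<gamma>(1) der)
  moreover have "((H \<circ> \<gamma>) has_derivative (\<lambda>t. 0)) (at 0)"
    by (rule has_derivative_transform_within_open[OF has_derivative_const[of c] open_ball[of 0 \<epsilon>]])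
      (use \<gamma>(2,3) in auto)
  ultimately have "(\<lambda>v. n \<bullet> v) \<circ> (\<lambda>t. t *\<^sub>R v) = (\<lambda>t. 0)"
    by (rule has_derivative_unique)
  from fun_cong[OF this, of 1] show "n \<bullet> v = 0" by simp
next
  fix v assume "v \<in> {v. n \<bullet> v = 0}"
  then have v: "n \<bullet> v = 0" by simp
  define zero where "zero t s \<longleftrightarrow> x + t *\<^sub>R v + s *\<^sub>R n \<in> {y \<in> U. H y = c}" for t s
  have small_zero: "\<exists>\<tau>>0. \<forall>t. \<bar>t\<bar> < \<tau> \<longrightarrow> (\<exists>s. \<bar>s\<bar> \<le> \<delta> * \<bar>t\<bar> \<and> zero t s)" if "\<delta> > 0" for \<delta> :: real
  proof -
    let ?K = "norm v + \<delta> * norm n"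
    have K: "?K > 0" using \<open>n \<noteq> 0\<close> that by (simp add: add_nonneg_pos)
    \<comment> \<open>With this accuracy the first-order change $\pm\delta|t||n|^2$ of $H$ at $s=\pm\delta|t|$ dominates the error.\<close>
    define e where "e = \<delta> * (n \<bullet> n) / ?K"
    have e: "e > 0" unfolding e_def using K that \<open>n \<noteq> 0\<close> by simp
    obtain d where d: "d > 0" "\<And>y. norm (y - x) < d \<Longrightarrow> \<bar>H y - H x - n \<bullet> (y - x)\<bar> \<le> e * norm (y - x)"
      using der e unfolding has_derivative_at_alt real_norm_def by meson
    obtain r where r: "r > 0" "ball x r \<subseteq> U" using assms(1,2) by (auto simp: open_contains_ball)
    define \<tau> where "\<tau> = min d r / ?K"
    show ?thesis
    proof (rule exI[of _ \<tau>], intro conjI allI impI)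
      show "\<tau> > 0" using K d r by (simp add: \<tau>_def)
      fix t assume t: "\<bar>t\<bar> < \<tau>"
      let ?y = "\<lambda>s. x + t *\<^sub>R v + s *\<^sub>R n"
      have bound: "norm (?y s - x) \<le> ?K * \<bar>t\<bar>" if "\<bar>s\<bar> \<le> \<delta> * \<bar>t\<bar>" for s
      proof -
        have "norm (?y s - x) \<le> \<bar>t\<bar> * norm v + \<bar>s\<bar> * norm n"
          using norm_triangle_ineq[of "t *\<^sub>R v" "s *\<^sub>R n"] by (simp add: algebra_simps)
        also have "\<dots> \<le> \<bar>t\<bar> * norm v + (\<delta> * \<bar>t\<bar>) * norm n"
          by (intro add_left_mono mult_right_mono that) auto
        finally show ?thesis by (simp add: algebra_simps)
      qed
      have "?K * \<bar>t\<bar> < min d r" using t K by (simp add: \<tau>_def field_simps)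
      then have near: "norm (?y s - x) < d" "norm (?y s - x) < r" if "\<bar>s\<bar> \<le> \<delta> * \<bar>t\<bar>" for s
        using bound[OF that] by auto
      have inU: "?y s \<in> U" if "\<bar>s\<bar> \<le> \<delta> * \<bar>t\<bar>" for s
      proof -
        have "?y s \<in> ball x r"
          using near(2)[OF that] by (simp only: mem_ball dist_norm norm_minus_commute[of x])
        then show ?thesis using r(2) by blast
      qed
      have approx: "\<bar>H (?y s) - c - s * (n \<bullet> n)\<bar> \<le> \<delta> * \<bar>t\<bar> * (n \<bullet> n)" if "\<bar>s\<bar> \<le> \<delta> * \<bar>t\<bar>" for s
      proof -
        have "\<bar>H (?y s) - H x - n \<bullet> (?y s - x)\<bar> \<le> e * norm (?y s - x)"
          using d(2) near(1)[OF that] by blast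
        also have "\<dots> \<le> e * (?K * \<bar>t\<bar>)" using bound[OF that] e by simp
        also have "\<dots> = \<delta> * \<bar>t\<bar> * (n \<bullet> n)" using K by (simp add: e_def)
        finally show ?thesis using v \<open>H x = c\<close> by (simp add: inner_add_right)
      qed
      have "continuous_on {- (\<delta> * \<bar>t\<bar>)..\<delta> * \<bar>t\<bar>} (\<lambda>s. H (?y s))"
        by (rule continuous_on_compose2[OF cont]) (auto intro!: continuous_intros inU)
      moreover have "H (?y (- (\<delta> * \<bar>t\<bar>))) \<le> c" "c \<le> H (?y (\<delta> * \<bar>t\<bar>))"
        using approx[of "- (\<delta> * \<bar>t\<bar>)"] approx[of "\<delta> * \<bar>t\<bar>"] \<open>\<delta> > 0\<close>
        by (simp_all add: abs_le_iff)
      moreover have "- (\<delta> * \<bar>t\<bar>) \<le> \<delta> * \<bar>t\<bar>" using \<open>\<delta> > 0\<close> by simp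
      ultimately obtain s where "- (\<delta> * \<bar>t\<bar>) \<le> s" "s \<le> \<delta> * \<bar>t\<bar>" "H (?y s) = c"
        using IVT'[of "\<lambda>s. H (?y s)" "- (\<delta> * \<bar>t\<bar>)" c "\<delta> * \<bar>t\<bar>"] by auto
      then show "\<exists>s. \<bar>s\<bar> \<le> \<delta> * \<bar>t\<bar> \<and> zero t s"
        by (intro exI[of _ s]) (auto simp: zero_def intro!: inU)
    qed
  qed
  \<comment> \<open>The slack $t^2=o(t)$ guarantees that a nearly minimal zero exists and does not affect the velocity.\<close>
  define nearly_minimal where
    "nearly_minimal t s \<longleftrightarrow> zero t s \<and> (\<forall>s'. zero t s' \<longrightarrow> \<bar>s\<bar> \<le> \<bar>s'\<bar> + t\<^sup>2)" for t s
  have ex: "\<exists>s. nearly_minimal t s" if "zero t s0" for t s0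
  proof (cases "t = 0")
    case True
    then show ?thesis using assms(2,3) by (intro exI[of _ 0]) (simp add: nearly_minimal_def zero_def)
  next
    case False
    let ?A = "abs ` Collect (zero t)"
    have "Inf ?A < Inf ?A + t\<^sup>2" using False by simp
    with that obtain s where s: "zero t s" "\<bar>s\<bar> < Inf ?A + t\<^sup>2"
      using cInf_lessD[of ?A "Inf ?A + t\<^sup>2"] by auto
    have "Inf ?A \<le> \<bar>s'\<bar>" if "zero t s'" for s'
      using that by (intro cInf_lower bdd_belowI[of _ 0]) auto
    then show ?thesis using s unfolding nearly_minimal_def by force
  qed
  define \<sigma> where "\<sigma> t = (SOME s. nearly_minimal t s)" for t
  have \<sigma>: "zero t (\<sigma> t)" "\<bar>\<sigma> t\<bar> \<le> \<bar>s\<bar> + t\<^sup>2" if "zero t s" for t s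
    using someI_ex[OF ex[OF that]] that unfolding \<sigma>_def nearly_minimal_def by auto
  have "\<sigma> 0 = 0" using \<sigma>(2)[of 0 0] assms(2,3) by (simp add: zero_def)
  let ?\<gamma> = "\<lambda>t. x + t *\<^sub>R v + \<sigma> t *\<^sub>R n"
  have "(?\<gamma> has_vector_derivative v) (at 0)"
    unfolding has_vector_derivative_def has_derivative_at_alt
  proof (intro conjI allI impI)
    show "bounded_linear (\<lambda>t. t *\<^sub>R v)" by (rule bounded_linear_scaleR_left)
    fix e :: real assume "e > 0"
    define \<delta> where "\<delta> = e / (2 * norm n)"
    have \<delta>: "\<delta> > 0" using \<open>e > 0\<close> \<open>n \<noteq> 0\<close> by (simp add: \<delta>_def)
    obtain \<tau> where \<tau>: "\<tau> > 0" "\<And>t. \<bar>t\<bar> < \<tau> \<Longrightarrow> \<exists>s. \<bar>s\<bar> \<le> \<delta> * \<bar>t\<bar> \<and> zero t s"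
      using small_zero[OF \<delta>] by blast
    show "\<exists>d>0. \<forall>t. norm (t - 0) < d \<longrightarrow> norm (?\<gamma> t - ?\<gamma> 0 - (t - 0) *\<^sub>R v) \<le> e * norm (t - 0)"
    proof (intro exI[of _ "min \<tau> \<delta>"] conjI allI impI)
      fix t :: real assume t: "norm (t - 0) < min \<tau> \<delta>"
      obtain s where s: "\<bar>s\<bar> \<le> \<delta> * \<bar>t\<bar>" "zero t s" using \<tau>(2) t by auto
      have "\<bar>t\<bar> * \<bar>t\<bar> \<le> \<delta> * \<bar>t\<bar>" using t by (intro mult_right_mono) auto
      then have "t\<^sup>2 \<le> \<delta> * \<bar>t\<bar>" by (simp add: power2_eq_square)
      then have "\<bar>\<sigma> t\<bar> \<le> 2 * \<delta> * \<bar>t\<bar>" using \<sigma>(2)[OF s(2)] s(1) by simp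
      then have "\<bar>\<sigma> t\<bar> * norm n \<le> (2 * \<delta> * \<bar>t\<bar>) * norm n" by (rule mult_right_mono) simp
      also have "\<dots> = e * \<bar>t\<bar>" using \<open>n \<noteq> 0\<close> by (simp add: \<delta>_def)
      finally show "norm (?\<gamma> t - ?\<gamma> 0 - (t - 0) *\<^sub>R v) \<le> e * norm (t - 0)"
        by (simp add: \<open>\<sigma> 0 = 0\<close>)
    qed (use \<tau>(1) \<delta> in simp)
  qed
  moreover obtain \<epsilon> where "\<epsilon> > 0" "\<And>t. \<bar>t\<bar> < \<epsilon> \<Longrightarrow> \<exists>s. zero t s"
    using small_zero[of 1] by fastforce
  then have "\<exists>\<epsilon>>0. \<forall>t. \<bar>t\<bar> < \<epsilon> \<longrightarrow> ?\<gamma> t \<in> {y \<in> U. H y = c}"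
    using \<sigma>(1) unfolding zero_def by blast
  ultimately show "v \<in> tangent_space {y \<in> U. H y = c} x"
    unfolding tangent_space_def by (intro CollectI exI[of _ ?\<gamma>]) (simp add: \<open>\<sigma> 0 = 0\<close>)
qed


section \<open>Closed forms positive on a volume-preserving field\<close>

lemma multilinear_form_0 [simp]: "multilinear_form 0 \<phi>"
  by (simp add: multilinear_form_def)

lemma multilinear_form_1I:
  assumes "linear L" shows "multilinear_form 1 (\<lambda>vs. L (vs ! 0))"
  using assms by (auto simp: multilinear_form_def linear_add linear_scale)

lemma multilinear_form_2I:
  assumes "bilinear B" shows "multilinear_form 2 (\<lambda>vs. B (vs ! 0) (vs ! 1))"
proof -
  have "B ((vs @ (a *\<^sub>R u + b *\<^sub>R w) # ws) ! 0) ((vs @ (a *\<^sub>R u + b *\<^sub>R w) # ws) ! 1)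
      = a * B ((vs @ u # ws) ! 0) ((vs @ u # ws) ! 1) + b * B ((vs @ w # ws) ! 0) ((vs @ w # ws) ! 1)"
    if "length vs + Suc (length ws) = 2" for vs ws u w a b
  proof -
    from that consider y where "vs = []" "ws = [y]" | y where "vs = [y]" "ws = []"
      by (cases vs; cases ws) auto
    then show ?thesis
      by cases (simp_all add: bilinear_ladd[OF assms] bilinear_radd[OF assms]
          bilinear_lmul[OF assms] bilinear_rmul[OF assms])
  qed
  then show ?thesis unfolding multilinear_form_def by blast
qed

text \<open>The geometric core. The field $X$ is tangent to the level sets of $H$ (gradient $G$) and divergence
  free, and a closed $1$-form $\alpha$, written as a vector field through the inner product, is
  positive on $X$. The transversal field $Y$ serves to divide the ambient volume by $dH$; the last
  assumption says that the Lie bracket $[X,Y]$ is tangent to the level sets, the differentiated form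
  of $dH(Y)=1$ and $dH(X)=0$.\<close>

locale irrotational_level_set =
  fixes U :: "'a::euclidean_space set" and H :: "'a \<Rightarrow> real" and G X Y \<alpha> :: "'a \<Rightarrow> 'a"
    and c :: real and k :: nat
  assumes open_U: "open U"
    and dimension: "DIM('a) = 2 * k + 2" and k_pos: "k \<ge> 1"
    and smooth_H: "smooth_on U H"
    and gradient: "x \<in> U \<Longrightarrow> (H has_derivative (\<lambda>v. G x \<bullet> v)) (at x)"
    and smooth_X: "smooth_on U X" and smooth_Y: "smooth_on U Y" and smooth_\<alpha>: "smooth_on U \<alpha>"
    and X_tangent: "x \<in> U \<Longrightarrow> G x \<bullet> X x = 0"
    and Y_transversal: "x \<in> U \<Longrightarrow> G x \<bullet> Y x = 1"
    and \<alpha>_positive: "x \<in> U \<Longrightarrow> \<alpha> x \<bullet> X x > 0"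
    and \<alpha>_closed: "x \<in> U \<Longrightarrow>
      frechet_derivative \<alpha> (at x) u \<bullet> v = frechet_derivative \<alpha> (at x) v \<bullet> u"
    and X_divergence_free: "x \<in> U \<Longrightarrow> (\<Sum>b\<in>Basis. frechet_derivative X (at x) b \<bullet> b) = 0"
    and bracket_tangent: "x \<in> U \<Longrightarrow>
      G x \<bullet> (frechet_derivative Y (at x) (X x) - frechet_derivative X (at x) (Y x)) = 0"
begin

definition M :: "'a set" where "M = {x \<in> U. H x = c}"

text \<open>The projection onto $\ker\alpha$ along $X$.\<close>

definition proj :: "'a \<Rightarrow> 'a \<Rightarrow> 'a" where
  "proj x v = v - ((\<alpha> x \<bullet> v) / (\<alpha> x \<bullet> X x)) *\<^sub>R X x"

text \<open>The metric with $\iota_Xg=\alpha$: it makes $X$ orthogonal to $\ker\alpha$, on which it is the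
  Euclidean one.\<close>

definition metric :: "'a tensor_field" where
  "metric x vs = (\<alpha> x \<bullet> vs ! 0) * (\<alpha> x \<bullet> vs ! 1) / (\<alpha> x \<bullet> X x) + proj x (vs ! 0) \<bullet> proj x (vs ! 1)"

text \<open>$\iota_Y\det$ restricts on the level set to the Leray quotient $\det/dH$.\<close>

definition volume :: "'a tensor_field" where
  "volume x vs = volume_det (Y x # vs)"

lemma M_subset_U: "M \<subseteq> U" by (auto simp: M_def)

lemma G_nonzero: "x \<in> U \<Longrightarrow> G x \<noteq> 0"
  using Y_transversal by force

lemma tangent_space_M: "x \<in> M \<Longrightarrow> tangent_space M x = {v. G x \<bullet> v = 0}"
  unfolding M_def
  by (rule tangent_space_level_set)
    (use open_U gradient G_nonzero smooth_on_imp_continuous_on[OF smooth_H] in auto)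

lemma smooth_hypersurface_M: "smooth_hypersurface M"
  unfolding smooth_hypersurface_def
proof (intro ballI exI[of _ U] exI[of _ "\<lambda>y. H y - c"] conjI)
  fix x y assume x: "x \<in> M" and "y \<in> M \<inter> U"
  then have y: "y \<in> U" by simp
  have "((\<lambda>y. H y - c) has_derivative (\<lambda>v. G y \<bullet> v)) (at y)"
    using has_derivative_diff[OF gradient[OF y] has_derivative_const[of c]] by simp
  then have "frechet_derivative (\<lambda>y. H y - c) (at y) (Y y) = 1"
    using frechet_derivative_at Y_transversal[OF y] by metis
  then show "\<exists>v. frechet_derivative (\<lambda>y. H y - c) (at y) v \<noteq> 0"
    by (intro exI[of _ "Y y"]) simp
qed (use open_U smooth_H in \<open>auto simp: M_def intro!: smooth_intros\<close>)

lemma vector_field_X: "vector_field M X"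
  unfolding vector_field_def
  using open_U smooth_X M_subset_U by (auto simp: tangent_space_M X_tangent)

lemma metric_X: "x \<in> U \<Longrightarrow> metric x [X x, v] = \<alpha> x \<bullet> v"
  using \<alpha>_positive[of x] by (simp add: metric_def proj_def)

lemma linear_proj: "linear (proj x)"
  by (rule linearI) (simp_all add: proj_def inner_add_right algebra_simps add_divide_distrib)

lemma riemannian_metric_M: "riemannian_metric M metric"
  unfolding riemannian_metric_def smooth_tensor_def
proof (intro conjI ballI impI)
  fix x assume "x \<in> M"
  have "bilinear (\<lambda>u v. (\<alpha> y \<bullet> u) * (\<alpha> y \<bullet> v) / (\<alpha> y \<bullet> X y) + proj y u \<bullet> proj y v)" for y
    unfolding bilinear_def
    by (auto intro!: linearI simp: inner_add_right inner_add_left linear_add[OF linear_proj]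
        linear_scale[OF linear_proj] algebra_simps add_divide_distrib)
  then have "multilinear_form 2 (metric y)" for y
    using multilinear_form_2I unfolding metric_def by blast
  moreover have "smooth_on U (\<lambda>y. metric y vs)" for vs
    unfolding metric_def proj_def
    by (intro smooth_intros open_U smooth_\<alpha> smooth_X \<alpha>_positive)
  ultimately show "\<exists>V A. open V \<and> x \<in> V \<and> ambient_tensor V 2 A \<and> restricts_to M V 2 A metric"
    using open_U \<open>x \<in> M\<close> M_subset_U unfolding ambient_tensor_def restricts_to_def by blast
next
  fix x v :: 'a assume x: "x \<in> M" and "v \<noteq> 0"
  then have pos: "\<alpha> x \<bullet> X x > 0" using \<alpha>_positive M_subset_U by blast
  show "metric x [v, v] > 0"
  proof (cases "\<alpha> x \<bullet> v = 0")
    case True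
    then show ?thesis using \<open>v \<noteq> 0\<close> by (simp add: metric_def proj_def)
  next
    case False
    then have "(\<alpha> x \<bullet> v) * (\<alpha> x \<bullet> v) / (\<alpha> x \<bullet> X x) > 0"
      using pos by (intro divide_pos_pos) (auto simp: zero_less_mult_iff linorder_neq_iff)
    then show ?thesis by (simp add: metric_def add_pos_nonneg)
  qed
qed (simp add: metric_def mult.commute inner_commute)

lemma multilinear_volume: "multilinear_form (2 * k + 1) (volume x)"
  unfolding multilinear_form_def volume_def
proof (intro allI impI)
  fix vs ws :: "'a list" and u w :: 'a and a b :: real
  assume len: "length vs + Suc (length ws) = 2 * k + 1"
  define L where "L z = volume_det ((Y x # vs @ 0 # ws)[Suc (length vs) := z])" for z
  have "linear L" unfolding L_def
    by (rule linear_volume_det_update) (use len dimension in auto)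
  then have "L (a *\<^sub>R u + b *\<^sub>R w) = a * L u + b * L w"
    by (simp add: linear_add linear_scale)
  then show "volume_det (Y x # vs @ (a *\<^sub>R u + b *\<^sub>R w) # ws)
      = a * volume_det (Y x # vs @ u # ws) + b * volume_det (Y x # vs @ w # ws)"
    by (simp add: L_def)
qed

lemma volume_Cons_zero:
  assumes "length vs = 2 * k"
  shows "volume x (0 # vs) = 0"
  using multilinear_volume[of x, unfolded multilinear_form_def, rule_format, of "[]" vs 0 0 0 0] assms
  by simp

lemma bounded_linear_volume_det_Cons:
  assumes "length vs = 2 * k + 1"
  shows "bounded_linear (\<lambda>w. volume_det ((w :: 'a) # vs))"
  using linear_volume_det_update[of "0 # vs" 0] assms dimension
  by (simp add: linear_conv_bounded_linear)

lemma ambient_form_volume: "ambient_form U (2 * k + 1) volume"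
  unfolding ambient_form_def ambient_tensor_def alternating_form_def
proof (intro conjI ballI allI impI multilinear_volume)
  fix vs :: "'a list" assume "length vs = 2 * k + 1"
  then show "smooth_on U (\<lambda>y. volume y vs)" unfolding volume_def
    by (rule bounded_linear.smooth_on[OF bounded_linear_volume_det_Cons open_U smooth_Y])
next
  fix y and vs :: "'a list" assume "length vs = 2 * k + 1 \<and> \<not> distinct vs"
  then show "volume y vs = 0" unfolding volume_def
    using dimension by (intro volume_det_not_distinct) auto
qed

text \<open>A vector orthogonal to $Y$ and to a basis of $\ker dH$ is orthogonal to everything, because
  $dH(Y)\neq0$; hence $Y$ together with such a basis has nonzero determinant.\<close>

lemma volume_nonzero:
  assumes "x \<in> M"
  shows "\<exists>vs\<in>tangent_tuples M x (2 * k + 1). volume x vs \<noteq> 0"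
proof -
  have x: "x \<in> U" using assms M_subset_U by blast
  obtain B where B: "B \<subseteq> {v. G x \<bullet> v = 0}" "independent B" "{v. G x \<bullet> v = 0} \<subseteq> span B"
      "card B = dim {v. G x \<bullet> v = 0}"
    using basis_exists by blast
  have "card B = 2 * k + 1"
    using B(4) dim_hyperplane[OF G_nonzero[OF x]] dimension by simp
  moreover have "finite B" using B(2) by (rule independent_imp_finite)
  ultimately obtain vs where vs: "set vs = B" "length vs = 2 * k + 1"
    by (metis finite_distinct_list distinct_card)
  have "volume x vs \<noteq> 0"
  proof
    assume "volume x vs = 0"
    then obtain z where z: "z \<noteq> 0" "Y x \<bullet> z = 0" "\<forall>v\<in>B. v \<bullet> z = 0"
      using volume_det_eq_0_iff[of "Y x # vs"] vs dimension by (auto simp: volume_def)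
    have "v \<bullet> z = 0" if "v \<in> span B" for v
      using that by (induction rule: span_induct_alt) (use z(3) in \<open>auto simp: inner_add_left\<close>)
    then have kernel: "v \<bullet> z = 0" if "G x \<bullet> v = 0" for v using that B(3) by blast
    have "G x \<bullet> (z - (G x \<bullet> z) *\<^sub>R Y x) = 0"
      using Y_transversal[OF x] by (simp add: inner_diff_right)
    from kernel[OF this] have "z \<bullet> z = 0" using z(2) by (simp add: inner_diff_left)
    then show False using z(1) by simp
  qed
  moreover have "vs \<in> tangent_tuples M x (2 * k + 1)"
    using vs B(1) by (simp add: tangent_tuples_def tangent_space_M[OF assms])
  ultimately show ?thesis by blast
qed

lemma volume_form_M: "volume_form M (2 * k + 1) volume"
  unfolding volume_form_def smooth_form_def restricts_to_def
  using ambient_form_volume open_U M_subset_U volume_nonzero by blast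

text \<open>With $Y$ as entry \<open>0\<close>, the trace identity gives
  $\mathcal L_X(\iota_Y\det)=(\operatorname{div}X)\,\iota_Y\det+\iota_{[X,Y]}\det$. The first term
  vanishes by assumption; the second vanishes on tangent vectors, since $[X,Y]$ and they are all
  orthogonal to $G$.\<close>

lemma ambient_lie_volume:
  assumes x: "x \<in> M" and vs: "vs \<in> tangent_tuples M x (2 * k + 1)"
  shows "ambient_lie X volume x vs = 0"
proof -
  have xU: "x \<in> U" using x M_subset_U by blast
  have len: "length vs = 2 * k + 1" and tangent: "\<forall>v\<in>set vs. G x \<bullet> v = 0"
    using vs by (auto simp: tangent_tuples_def tangent_space_M[OF x])
  let ?DX = "frechet_derivative X (at x)" and ?DY = "frechet_derivative Y (at x)"
  note L = bounded_linear_volume_det_Cons[OF len]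
  have "((\<lambda>z. volume z vs) has_derivative (\<lambda>v. volume_det (?DY v # vs))) (at x)"
    unfolding volume_def
    by (rule bounded_linear.has_derivative[OF L smooth_on_imp_has_derivative[OF smooth_Y xU]])
  then have 1: "frechet_derivative (\<lambda>z. volume z vs) (at x) (X x) = volume_det (?DY (X x) # vs)"
    by (metis frechet_derivative_at)
  have "linear ?DX" using smooth_on_imp_has_derivative[OF smooth_X xU]
    by (rule has_derivative_linear)
  from sum_volume_det_update_linear[OF _ this, of "Y x # vs"]
  have "(\<Sum>i<Suc (length vs). volume_det ((Y x # vs)[i := ?DX ((Y x # vs) ! i)])) = 0"
    using len dimension X_divergence_free[OF xU] by simp
  then have 2: "volume_det (?DX (Y x) # vs) + (\<Sum>i<length vs. volume x (vs[i := ?DX (vs ! i)])) = 0"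
    by (simp add: sum.lessThan_Suc_shift volume_def del: sum.lessThan_Suc)
  have "ambient_lie X volume x vs = volume_det ((?DY (X x) - ?DX (Y x)) # vs)"
    using 1 2 linear_diff[OF bounded_linear.linear[OF L]] by (simp add: ambient_lie_def)
  also have "\<dots> = 0"
    unfolding volume_det_eq_0_iff[of "(?DY (X x) - ?DX (Y x)) # vs", unfolded length_Cons len dimension, simplified]
    using tangent G_nonzero[OF xU] bracket_tangent[OF xU]
    by (intro exI[of _ "G x"]) (simp add: inner_commute)
  finally show ?thesis .
qed

lemma volume_preserving_X: "volume_preserving M k volume X"
  unfolding volume_preserving_def has_lie_derivative_def restricts_to_def
proof (intro ballI exI[of _ U] exI[of _ X] exI[of _ volume] conjI)
qed (use ambient_form_volume open_U M_subset_U smooth_X ambient_lie_volume in auto)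

text \<open>This is \<open>\<alpha>_closed\<close>, because $\iota_Xg=\alpha$ on the level set.\<close>

lemma exterior_derivative_metric_X: "has_exterior_derivative M 1 (contract X metric) (\<lambda>x vs. 0)"
  unfolding has_exterior_derivative_def
proof (intro ballI exI[of _ U] exI[of _ "\<lambda>y vs. \<alpha> y \<bullet> vs ! 0"] conjI)
  show "ambient_form U 1 (\<lambda>y vs. \<alpha> y \<bullet> vs ! 0)"
    unfolding ambient_form_def ambient_tensor_def alternating_form_def
  proof (intro conjI ballI allI impI)
    have linear_form: "multilinear_form 1 (\<lambda>vs. \<alpha> y \<bullet> vs ! 0)" for y
      by (intro multilinear_form_1I bounded_linear.linear bounded_linear_inner_right)
    show "multilinear_form 1 (\<lambda>vs. \<alpha> y \<bullet> vs ! 0)" "multilinear_form 1 (\<lambda>vs. \<alpha> y \<bullet> vs ! 0)" for y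
      by (rule linear_form)+
    show "smooth_on U (\<lambda>y. \<alpha> y \<bullet> vs ! 0)" for vs by (intro smooth_intros open_U smooth_\<alpha>)
    fix y and vs :: "'a list" assume "length vs = 1 \<and> \<not> distinct vs"
    then show "\<alpha> y \<bullet> vs ! 0 = 0" by (cases vs) auto
  qed
  show "restricts_to M U 1 (\<lambda>y vs. \<alpha> y \<bullet> vs ! 0) (contract X metric)"
    using metric_X by (auto simp: restricts_to_def contract_def tangent_tuples_def length_Suc_conv)
  have "ambient_d (\<lambda>y vs. \<alpha> y \<bullet> vs ! 0) y [u, v] = 0" if "y \<in> U" for y u v
  proof -
    have "frechet_derivative (\<lambda>z. \<alpha> z \<bullet> w) (at y) = (\<lambda>u. frechet_derivative \<alpha> (at y) u \<bullet> w)" for w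
      by (rule frechet_derivative_at[symmetric])
        (rule has_derivative_inner_left[OF smooth_on_imp_has_derivative[OF smooth_\<alpha> that]])
    then show ?thesis using \<alpha>_closed[OF that, of u v]
      by (simp add: ambient_d_def numeral_2_eq_2)
  qed
  then show "restricts_to M U (Suc 1) (ambient_d (\<lambda>y vs. \<alpha> y \<bullet> vs ! 0)) (\<lambda>x vs. 0)"
    by (auto simp: restricts_to_def tangent_tuples_def length_Suc_conv)
qed (use open_U M_subset_U in auto)

lemma wedge_power_of_zero: "j \<ge> 1 \<Longrightarrow> wedge_power (\<lambda>x vs. 0) j x vs = 0"
  by (cases j) (simp_all add: wedge_def)

lemma ambient_form_0: "open V \<Longrightarrow> smooth_on V f \<Longrightarrow> ambient_form V 0 (function_tensor f)"
  by (simp add: ambient_form_def ambient_tensor_def alternating_form_def)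

text \<open>Since $d\iota_Xg=0$ and $k\geq1$, the curl is zero, so the proportionality factor is \<open>0\<close>.\<close>

lemma beltrami_X: "beltrami M k metric volume X"
  unfolding beltrami_def
proof (intro conjI exI[of _ "\<lambda>x. 0"] vector_field_X volume_preserving_X)
  show "smooth_tensor M 0 (function_tensor (\<lambda>x. 0))"
    unfolding smooth_tensor_def ambient_tensor_def restricts_to_def
    using smooth_on_const by (auto intro!: exI[of _ UNIV] exI[of _ "\<lambda>x vs. 0"])
  show "is_curl M k metric volume X (\<lambda>x. 0 *\<^sub>R X x)"
    unfolding is_curl_def
  proof (intro conjI exI[of _ "\<lambda>x vs. 0"] exterior_derivative_metric_X ballI)
    show "vector_field M (\<lambda>x. 0 *\<^sub>R X x)"
      unfolding vector_field_def using smooth_on_const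
      by (auto simp: tangent_space_M intro!: exI[of _ UNIV] exI[of _ "\<lambda>x. 0"])
  qed (use k_pos in \<open>auto simp: contract_def wedge_power_of_zero volume_Cons_zero tangent_tuples_def\<close>)
qed

text \<open>Both sides of the Euler equation vanish, with a constant Bernoulli function.\<close>

lemma stationary_euler_X: "stationary_euler M k metric volume X"
  unfolding stationary_euler_def
proof (intro conjI exI[of _ "\<lambda>x. 0"] exI[of _ "\<lambda>x vs. 0"] vector_field_X volume_preserving_X
    exterior_derivative_metric_X)
  show "has_exterior_derivative M 0 (function_tensor (\<lambda>x. 0)) (\<lambda>x vs. 0)"
    unfolding has_exterior_derivative_def restricts_to_def
    using ambient_form_0[OF open_UNIV smooth_on_const]
    by (auto intro!: exI[of _ UNIV] exI[of _ "\<lambda>x vs. 0"] simp: ambient_d_def)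
qed (simp add: contract_def)

end


section \<open>The n-body Hamiltonian field\<close>

lemma smooth_on_norm [smooth_intros]:
  fixes f :: "'a::euclidean_space \<Rightarrow> 'b::real_inner"
  assumes "open S" "smooth_on S f" "\<And>x. x \<in> S \<Longrightarrow> f x \<noteq> 0"
  shows "smooth_on S (\<lambda>x. norm (f x))"
proof -
  have "smooth_on S (\<lambda>x. (f x \<bullet> f x) powr (1/2))"
    using assms(3) by (intro smooth_intros assms(1,2)) simp
  then show ?thesis by (simp add: powr_half_sqrt norm_eq_sqrt_inner)
qed

lemma bounded_linear_axis: "bounded_linear (axis i :: 'b::euclidean_space \<Rightarrow> 'b ^ 'n)"
  unfolding linear_conv_bounded_linear[symmetric]
  by (rule linearI) (auto simp: Finite_Cartesian_Product.vec_eq_iff axis_def)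

lemmas smooth_on_axis [smooth_intros] = bounded_linear.smooth_on[OF bounded_linear_axis]

definition configurations :: "(real ^ 'd ^ 'n) set" where
  "configurations = {q. \<forall>i j. i \<noteq> j \<longrightarrow> q $ i \<noteq> q $ j}"

lemma open_configurations: "open (configurations :: (real ^ 'd ^ 'n) set)"
proof -
  have "configurations = (\<Inter>i. \<Inter>j\<in>-{i}. {q :: real ^ 'd ^ 'n. q $ i \<noteq> q $ j})"
    by (auto simp: configurations_def)
  also have "open \<dots>" by (intro open_INT finite ballI open_Collect_neq continuous_intros)
  finally show ?thesis .
qed

lemma phase_space_eq: "phase_space = configurations \<times> UNIV"
  by (auto simp: phase_space_def configurations_def)

lemma open_phase_space: "open phase_space"
  unfolding phase_space_eq by (intro open_Times open_configurations open_UNIV)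

text \<open>The Hamiltonian field has \<open>velocity\<close> and \<open>force\<close> as its components. The potential carries the
  sign that makes it positive, so that $H$ is kinetic energy minus \<open>newton_potential\<close> and \<open>force\<close> is
  its gradient.\<close>

definition velocity :: "('n::finite \<Rightarrow> real) \<Rightarrow> real ^ 'd ^ 'n \<Rightarrow> real ^ 'd ^ 'n" where
  "velocity m p = (\<chi> i. p $ i /\<^sub>R m i)"

definition newton_potential :: "('n::{finite,linorder} \<Rightarrow> real) \<Rightarrow> real ^ 'd ^ ('n::{finite,linorder}) \<Rightarrow> real" where
  "newton_potential m q = (\<Sum>(i, j) | i < j. m i * m j / norm (q $ i - q $ j))"

definition force :: "('n::{finite,linorder} \<Rightarrow> real) \<Rightarrow> real ^ 'd ^ ('n::{finite,linorder}) \<Rightarrow> real ^ 'd ^ ('n::{finite,linorder})" where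
  "force m q = (\<Sum>(i, j) | i < j. - (m i * m j / norm (q $ i - q $ j) ^ 3) *\<^sub>R
     (axis i (q $ i - q $ j) - axis j (q $ i - q $ j)))"

lemma linear_velocity: "linear (velocity m)"
  by (rule linearI) (simp_all add: velocity_def Finite_Cartesian_Product.vec_eq_iff algebra_simps)

lemma bounded_linear_velocity: "bounded_linear (velocity m)"
  using linear_velocity linear_conv_bounded_linear by blast

lemmas smooth_on_velocity [smooth_intros] = bounded_linear.smooth_on[OF bounded_linear_velocity]

lemma inner_velocity_commute: "velocity m u \<bullet> v = u \<bullet> velocity m v"
  by (simp add: velocity_def inner_vec_def[of "\<chi> i. u $ i /\<^sub>R m i"] inner_vec_def[of u])

lemma nbody_hamiltonian_eq:
  "nbody_hamiltonian m (q, p) = (p \<bullet> velocity m p) / 2 - newton_potential m q"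
proof -
  have "(\<Sum>i\<in>UNIV. (norm (p $ i))\<^sup>2 / (2 * m i)) = (p \<bullet> velocity m p) / 2"
    unfolding inner_vec_def[of p] velocity_def sum_divide_distrib
    by (intro sum.cong refl) (simp add: power2_norm_eq_inner field_simps)
  then show ?thesis by (simp add: nbody_hamiltonian_def newton_potential_def)
qed

lemma nbody_hamiltonian_eq_fun:
  "nbody_hamiltonian m = (\<lambda>x. (1/2) * (snd x \<bullet> velocity m (snd x)) - newton_potential m (fst x))"
  by (auto simp: nbody_hamiltonian_eq)

lemma newton_potential_nonneg: "(\<And>i. m i > 0) \<Longrightarrow> newton_potential m q \<ge> 0"
  unfolding newton_potential_def by (intro sum_nonneg) (auto simp: less_imp_le)

lemma smooth_on_force [smooth_intros]:
  assumes "open S" "smooth_on S f" "\<And>x. x \<in> S \<Longrightarrow> f x \<in> configurations"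
  shows "smooth_on S (\<lambda>x. force m (f x))"
proof -
  have "smooth_on S (\<lambda>x. case ij of (i, j) \<Rightarrow> - (m i * m j / norm (f x $ i - f x $ j) ^ 3) *\<^sub>R
     (axis i (f x $ i - f x $ j) - axis j (f x $ i - f x $ j)))" if "ij \<in> {(i, j). i < j}" for ij
    using that
    by (cases ij, clarsimp, intro smooth_intros assms(1,2)) (use assms(3) in \<open>auto simp: configurations_def\<close>)
  then show ?thesis unfolding force_def by (intro smooth_on_sum assms(1))
qed

lemma smooth_on_newton_potential [smooth_intros]:
  assumes "open S" "smooth_on S f" "\<And>x. x \<in> S \<Longrightarrow> f x \<in> configurations"
  shows "smooth_on S (\<lambda>x. newton_potential m (f x))"
proof -
  have "smooth_on S (\<lambda>x. case ij of (i, j) \<Rightarrow> m i * m j / norm (f x $ i - f x $ j))"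
    if "ij \<in> {(i, j). i < j}" for ij
    using that
    by (cases ij, clarsimp, intro smooth_intros assms(1,2)) (use assms(3) in \<open>auto simp: configurations_def\<close>)
  then show ?thesis unfolding newton_potential_def by (intro smooth_on_sum assms(1))
qed

lemma force_has_derivative:
  assumes "q \<in> configurations"
  shows "(force m has_derivative frechet_derivative (force m) (at q)) (at q)"
  by (rule smooth_on_imp_has_derivative[OF _ assms]) (intro smooth_intros open_configurations)

lemma newton_potential_has_derivative:
  assumes "q \<in> configurations"
  shows "(newton_potential m has_derivative (\<lambda>v. force m q \<bullet> v)) (at q)"
proof -
  have summand: "((\<lambda>q. case ij of (i, j) \<Rightarrow> m i * m j / norm (q $ i - q $ j)) has_derivative
      (\<lambda>v. (case ij of (i, j) \<Rightarrow> - (m i * m j / norm (q $ i - q $ j) ^ 3) *\<^sub>R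
        (axis i (q $ i - q $ j) - axis j (q $ i - q $ j))) \<bullet> v)) (at q)"
    if "ij \<in> {(i, j). i < j}" for ij
  proof -
    from that obtain i j where ij: "ij = (i, j)" "i < j" by (cases ij) auto
    define r where "r = q $ i - q $ j"
    have "r \<noteq> 0" using assms ij by (auto simp: r_def configurations_def)
    have "((\<lambda>q. q $ i - q $ j) has_derivative (\<lambda>v. v $ i - v $ j)) (at q)"
      by (intro has_derivative_diff bounded_linear_imp_has_derivative bounded_linear_vec_nth)
    from has_derivative_compose[OF this, of norm "\<lambda>h. h \<bullet> sgn r"]
    have "((\<lambda>q. norm (q $ i - q $ j)) has_derivative (\<lambda>v. (v $ i - v $ j) \<bullet> sgn r)) (at q)"
      using has_derivative_norm[OF \<open>r \<noteq> 0\<close>] unfolding r_def by simp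
    from has_derivative_divide[OF has_derivative_const this, of "m i * m j"]
    have "((\<lambda>q. m i * m j / norm (q $ i - q $ j)) has_derivative
        (\<lambda>v. - (m i * m j * (inverse (norm r) * ((v $ i - v $ j) \<bullet> sgn r) * inverse (norm r))))) (at q)"
      using \<open>r \<noteq> 0\<close> by (simp add: r_def)
    also have "(\<lambda>v. - (m i * m j * (inverse (norm r) * ((v $ i - v $ j) \<bullet> sgn r) * inverse (norm r))))
        = (\<lambda>v. (- (m i * m j / norm r ^ 3) *\<^sub>R (axis i r - axis j r)) \<bullet> v)"
      using \<open>r \<noteq> 0\<close>
      by (auto simp: fun_eq_iff sgn_div_norm inner_diff_left inner_diff_right inner_axis' 
          inner_commute[of _ r]
          power3_eq_cube field_simps)
    finally show ?thesis by (simp add: ij r_def)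
  qed
  show ?thesis
    unfolding newton_potential_def[abs_def] force_def inner_sum_left
    by (rule has_derivative_sum) (rule summand)
qed

text \<open>Euler's identity for the potential, homogeneous of degree $-1$.\<close>

lemma force_inner_self:
  assumes "q \<in> configurations"
  shows "force m q \<bullet> q = - newton_potential m q"
proof -
  have "(case ij of (i, j) \<Rightarrow> - (m i * m j / norm (q $ i - q $ j) ^ 3) *\<^sub>R
        (axis i (q $ i - q $ j) - axis j (q $ i - q $ j))) \<bullet> q
      = - (case ij of (i, j) \<Rightarrow> m i * m j / norm (q $ i - q $ j))" if "ij \<in> {(i, j). i < j}" for ij
  proof -
    from that obtain i j where ij: "ij = (i, j)" "i < j" by (cases ij) auto
    define r where "r = q $ i - q $ j"
    have "r \<noteq> 0" using assms ij by (auto simp: r_def configurations_def)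
    have "(axis i r - axis j r) \<bullet> q = norm r ^ 2"
      by (simp add: inner_diff_left inner_diff_right inner_axis' r_def power2_norm_eq_inner)
    then have "(- (m i * m j / norm r ^ 3) *\<^sub>R (axis i r - axis j r)) \<bullet> q = - (m i * m j / norm r)"
      using \<open>r \<noteq> 0\<close> by (simp add: power3_eq_cube power2_eq_square)
    then show ?thesis by (simp add: ij r_def)
  qed
  then show ?thesis
    unfolding newton_potential_def force_def inner_sum_left sum_negf[symmetric]
    by (intro sum.cong refl) blast
qed

lemma inner_velocity_has_derivative:
  "((\<lambda>x. snd x \<bullet> velocity m (snd x)) has_derivative (\<lambda>v. 2 * (velocity m p \<bullet> snd v))) (at (q, p))"
proof -
  have "((\<lambda>x. velocity m (snd x)) has_derivative (\<lambda>v. velocity m (snd v))) (at (q, p))"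
    by (intro bounded_linear.has_derivative[OF bounded_linear_velocity] has_derivative_snd has_derivative_ident)
  from has_derivative_inner[OF has_derivative_snd[OF has_derivative_ident] this] show ?thesis
    by (rule has_derivative_eq_rhs)
      (simp add: fun_eq_iff inner_velocity_commute[of m p, symmetric] inner_commute[of _ "velocity m p"])
qed

lemma nbody_hamiltonian_has_derivative:
  assumes "(q, p) \<in> phase_space"
  shows "(nbody_hamiltonian m has_derivative (\<lambda>v. (- force m q, velocity m p) \<bullet> v)) (at (q, p))"
proof -
  have q: "q \<in> configurations" using assms by (simp add: phase_space_eq)
  have 1: "((\<lambda>x. newton_potential m (fst x)) has_derivative (\<lambda>v. force m q \<bullet> fst v)) (at (q, p))"
    by (rule has_derivative_compose[OF has_derivative_fst[OF has_derivative_ident]])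
      (simp add: newton_potential_has_derivative[OF q])
  show ?thesis
    using has_derivative_diff[OF has_derivative_mult_right[OF inner_velocity_has_derivative, of "1/2"] 1]
    by (simp add: nbody_hamiltonian_eq_fun inner_prod_def)
qed

lemma smooth_nbody_hamiltonian: "smooth_on phase_space (nbody_hamiltonian m)"
  unfolding nbody_hamiltonian_eq_fun
  by (intro smooth_intros open_phase_space) (auto simp: phase_space_eq)

lemma symplectic_form_eq: "symplectic_form u v = snd u \<bullet> fst v - fst u \<bullet> snd v"
  unfolding symplectic_form_def inner_vec_def[of "snd u" "fst v"] inner_vec_def[of "fst u" "snd v"]
    sum_subtractf by (simp add: inner_commute)

lemma hamiltonian_vector_field_nbody:
  assumes "x \<in> phase_space"
  shows "hamiltonian_vector_field (nbody_hamiltonian m) x = (velocity m (snd x), force m (fst x))"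
proof -
  have D: "frechet_derivative (nbody_hamiltonian m) (at x) = (\<lambda>v. (- force m (fst x), velocity m (snd x)) \<bullet> v)"
    using nbody_hamiltonian_has_derivative[of "fst x" "snd x" m] assms frechet_derivative_at by fastforce
  show ?thesis unfolding hamiltonian_vector_field_def D
  proof (rule the_equality)
    fix X assume X: "\<forall>v. symplectic_form X v = - ((- force m (fst x), velocity m (snd x)) \<bullet> v)"
    have "snd X \<bullet> a = force m (fst x) \<bullet> a" for a
      using X[rule_format, of "(a, 0)"] by (simp add: symplectic_form_eq)
    moreover have "fst X \<bullet> a = velocity m (snd x) \<bullet> a" for a
      using X[rule_format, of "(0, a)"] by (simp add: symplectic_form_eq)
    ultimately show "X = (velocity m (snd x), force m (fst x))"
      by (metis prod.collapse vector_eq_rdot)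
  qed (simp add: symplectic_form_eq inner_prod_def)
qed

text \<open>Scaling of the momenta, normalised by twice the kinetic energy so that $dH$ takes the value \<open>1\<close>
  on it. Its bracket with $X_H$ involves only first derivatives of the potential.\<close>

definition radial :: "('n::finite \<Rightarrow> real) \<Rightarrow> ('d::finite, 'n) phase \<Rightarrow> ('d, 'n) phase" where
  "radial m x = (0, (1 / (snd x \<bullet> velocity m (snd x))) *\<^sub>R snd x)"

lemma radial_has_derivative:
  assumes "p \<bullet> velocity m p \<noteq> 0"
  shows "(radial m has_derivative (\<lambda>u. (0, (1 / (p \<bullet> velocity m p)) *\<^sub>R snd u
    - (2 * (velocity m p \<bullet> snd u) / (p \<bullet> velocity m p)\<^sup>2) *\<^sub>R p))) (at (q, p))"
proof -
  show ?thesis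
    unfolding radial_def[abs_def]
    by (rule has_derivative_eq_rhs[OF has_derivative_Pair[OF has_derivative_const
          has_derivative_scaleR[OF has_derivative_divide[OF has_derivative_const inner_velocity_has_derivative]
            has_derivative_snd[OF has_derivative_ident]]]])
      (use assms in \<open>auto simp: fun_eq_iff power2_eq_square field_simps\<close>)
qed

text \<open>Here $\alpha=d(q\cdot p)$. Its value on $X_H$ is $2K-V$ for the kinetic energy $K$ and the potential
  $V$ (both nonnegative), which is $K+H$: the Lagrange--Jacobi identity. It is therefore positive
  wherever $H$ is. The field $X_H$ is divergence free because $\dot q$ depends on $p$ alone and
  $\dot p$ on $q$ alone.\<close>

lemma irrotational_level_set_nbody:
  fixes m :: "'n::{finite,linorder} \<Rightarrow> real"
  assumes "CARD('n) \<ge> 2" and mass: "\<And>i. m i > 0"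
    and k: "2 * k + 1 = 2 * CARD('d::finite) * CARD('n) - 1"
  shows "irrotational_level_set
    {x \<in> phase_space :: ('d, 'n) phase set. nbody_hamiltonian m x > 0} (nbody_hamiltonian m)
    (\<lambda>x. (- force m (fst x), velocity m (snd x))) (hamiltonian_vector_field (nbody_hamiltonian m))
    (radial m) (\<lambda>x. (snd x, fst x)) k"
proof
  let ?H = "nbody_hamiltonian m :: ('d, 'n) phase \<Rightarrow> real"
  let ?X = "hamiltonian_vector_field ?H"
  let ?U = "{x \<in> phase_space :: ('d, 'n) phase set. ?H x > 0}"
  show U: "open ?U"
  proof -
    have "open (?H -` {0<..} \<inter> phase_space)"
      by (rule continuous_on_open_vimage[THEN iffD1, rule_format, OF open_phase_space])
        (auto intro!: smooth_on_imp_continuous_on smooth_nbody_hamiltonian)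
    moreover have "?U = ?H -` {0<..} \<inter> phase_space" by auto
    ultimately show ?thesis by metis
  qed
  have kinetic: "snd x \<bullet> velocity m (snd x) > 0" if "x \<in> ?U" for x
    using that newton_potential_nonneg[of m "fst x"] mass nbody_hamiltonian_eq[of m "fst x" "snd x"] by simp
  have X: "?X x = (velocity m (snd x), force m (fst x))" if "x \<in> ?U" for x
    using that hamiltonian_vector_field_nbody by blast
  have X_has_derivative: "(?X has_derivative
      (\<lambda>u. (velocity m (snd u), frechet_derivative (force m) (at (fst x)) (fst u)))) (at x)" if "x \<in> ?U" for x
  proof (rule has_derivative_transform_within_open[OF _ U that])
    have "(force m has_derivative frechet_derivative (force m) (at (fst x))) (at (fst x))"
      using that by (intro force_has_derivative) (auto simp: phase_space_eq)
    then show "((\<lambda>x. (velocity m (snd x), force m (fst x))) has_derivative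
        (\<lambda>u. (velocity m (snd u), frechet_derivative (force m) (at (fst x)) (fst u)))) (at x)"
      by (intro has_derivative_Pair bounded_linear.has_derivative[OF bounded_linear_velocity]
          has_derivative_compose[OF has_derivative_fst[OF has_derivative_ident]]
          has_derivative_snd has_derivative_ident)
  qed (use X in simp)
  have linear_force: "linear (frechet_derivative (force m) (at (fst x)))" if "x \<in> ?U" for x
    using that by (intro has_derivative_linear[OF force_has_derivative]) (auto simp: phase_space_eq)
  have "CARD('d) * CARD('n) \<ge> 1 * 2" using assms(1) by (intro mult_le_mono) (simp_all add: Suc_le_eq)
  then show "k \<ge> 1" "DIM(('d, 'n) phase) = 2 * k + 2" using k by simp_all
  show "smooth_on ?U ?H" by (rule smooth_on_subset[OF smooth_nbody_hamiltonian]) auto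
  have "smooth_on ?U (\<lambda>x. (velocity m (snd x), force m (fst x)))"
    by (intro smooth_intros U) (auto simp: phase_space_eq)
  moreover have "smooth_on ?U ?X \<longleftrightarrow> smooth_on ?U (\<lambda>x. (velocity m (snd x), force m (fst x)))"
    by (rule smooth_on_cong[OF U]) (rule X)
  ultimately show "smooth_on ?U ?X" by blast
  show "smooth_on ?U (radial m)" unfolding radial_def[abs_def]
    by (intro smooth_intros U kinetic)
  show "smooth_on ?U (\<lambda>x. (snd x, fst x))" by (intro smooth_intros U)
  fix x assume x: "x \<in> ?U"
  obtain q p where qp: "x = (q, p)" by (cases x)
  let ?s = "p \<bullet> velocity m p"
  have s: "?s > 0" using kinetic[OF x] by (simp add: qp)
  show "(?H has_derivative (\<lambda>v. (- force m (fst x), velocity m (snd x)) \<bullet> v)) (at x)"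
    using nbody_hamiltonian_has_derivative[of q p m] x by (simp add: qp)
  show "(- force m (fst x), velocity m (snd x)) \<bullet> ?X x = 0"
    by (simp add: X[OF x] inner_commute)
  show "(- force m (fst x), velocity m (snd x)) \<bullet> radial m x = 1"
    using s by (simp add: radial_def qp inner_commute)
  show "(snd x, fst x) \<bullet> ?X x > 0"
  proof -
    have "(snd x, fst x) \<bullet> ?X x = ?s - newton_potential m q"
      using force_inner_self[of q m] x by (simp add: X[OF x, unfolded qp fst_conv snd_conv] qp inner_commute phase_space_eq)
    also have "\<dots> = ?s / 2 + ?H x" by (simp add: qp nbody_hamiltonian_eq)
    finally show ?thesis using s x by simp
  qed
  have DX: "frechet_derivative ?X (at x)
      = (\<lambda>u. (velocity m (snd u), frechet_derivative (force m) (at (fst x)) (fst u)))"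
    using frechet_derivative_at[OF X_has_derivative[OF x]] by simp
  show "(\<Sum>b\<in>Basis. frechet_derivative ?X (at x) b \<bullet> b) = 0"
    unfolding DX
    by (rule sum.neutral) (auto simp: Basis_prod_def linear_0[OF linear_velocity] linear_0[OF linear_force[OF x]])
  have DY: "frechet_derivative (radial m) (at x)
      = (\<lambda>u. (0, (1 / ?s) *\<^sub>R snd u - (2 * (velocity m p \<bullet> snd u) / ?s\<^sup>2) *\<^sub>R p))"
    using frechet_derivative_at[OF radial_has_derivative[of p m q]] s by (simp add: qp)
  show "(- force m (fst x), velocity m (snd x)) \<bullet>
      (frechet_derivative (radial m) (at x) (?X x) - frechet_derivative ?X (at x) (radial m x)) = 0"
    unfolding DX DY X[OF x] using s
    by (simp add: radial_def qp linear_0[OF linear_force[OF x], unfolded qp fst_conv] linear_scale[OF linear_velocity]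
        inner_diff_right inner_commute power2_eq_square field_simps)
  fix u v
  have "frechet_derivative (\<lambda>x. (snd x, fst x)) (at x) = (\<lambda>x. (snd x, fst x))"
    by (rule frechet_derivative_at[symmetric]) (auto intro!: derivative_intros)
  then show "frechet_derivative (\<lambda>x. (snd x, fst x)) (at x) u \<bullet> v
      = frechet_derivative (\<lambda>x. (snd x, fst x)) (at x) v \<bullet> u"
    by (simp add: inner_prod_def inner_commute add.commute)
qed

theorem corollary1p6:
  fixes m :: "'n::{finite,linorder} \<Rightarrow> real"
    and c :: real
    and k :: nat
    and \<Sigma> :: "('d::finite, 'n) phase set"
  assumes "CARD('n) \<ge> 2"
    and "\<forall>i. m i > 0"
    and "c > 0"
    and "\<Sigma> = {x \<in> phase_space. nbody_hamiltonian m x = c}"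
    and "2 * k + 1 = 2 * CARD('d) * CARD('n) - 1"
  shows "smooth_hypersurface \<Sigma> \<and>
    (\<exists>g. riemannian_metric \<Sigma> g \<and>
      (\<exists>\<mu>. volume_form \<Sigma> (2 * k + 1) \<mu> \<and>
        beltrami \<Sigma> k g \<mu> (hamiltonian_vector_field (nbody_hamiltonian m)) \<and>
        stationary_euler \<Sigma> k g \<mu> (hamiltonian_vector_field (nbody_hamiltonian m))))"
proof -
  interpret irrotational_level_set
    "{x \<in> phase_space :: ('d, 'n) phase set. nbody_hamiltonian m x > 0}" "nbody_hamiltonian m"
    "\<lambda>x. (- force m (fst x), velocity m (snd x))" "hamiltonian_vector_field (nbody_hamiltonian m)"
    "radial m" "\<lambda>x. (snd x, fst x)" c k
    using irrotational_level_set_nbody[OF assms(1) _ assms(5)] assms(2) by blast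
  have "\<Sigma> = M" using assms(3,4) unfolding M_def by auto
  then show ?thesis
    using smooth_hypersurface_M riemannian_metric_M volume_form_M beltrami_X stationary_euler_X by blast
qed

end
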